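(* (Generalised Littlewood-Richardson rule, binary formulation.) For all $\kappa,\lambda,\mu,\nu\in\mathcal P$: $$ \langle s_{\lambda/\kappa},s_{\nu/\mu}\rangle=\sum_{M\in\mathcal M^{[2]}_{\nu-\mu,\;\lambda^t-\kappa^t}}\Bigl[\forall k\in\mathbf N:\ \kappa^t+\sum_{i<k}M_i\in\mathcal P\Bigr]\,\Bigl[\forall l\in\mathbf N:\ \mu+\sum_{j\ge l}M^t_j\in\mathcal P\Bigr]. $$
   Context: $\mathbf N=\{0,1,2,\ldots\}$. A composition is a finitely supported sequence $\alpha=(\alpha_i)_{i\in\mathbf N}$ of natural numbers; $\mathcal C$ is the set of all compositions, added entrywise. $\mathcal P\subset\mathcal C$ is the set of partitions, i.e. weakly decreasing compositions; $\lambda^t$ is the transpose partition, $\lambda^t_j=\#\{i: j<\lambda_i\}$. Finite vectors are extended by zeros, so $\mathbf N^n\subset\mathcal C$. The Iverson bracket $[\text{condition}]$ is $1$ if the condition holds and $0$ otherwise. Matrices: $\mathcal M^{[2]}$ is the set of matrices $M=(M_{i,j})_{i,j\in\mathbf N}$ with entries in $\{0,1\}$, only finitely many nonzero. $M_i=(M_{i,j})_{j\in\mathbf N}$ is row $i$ and $M^t_j=(M_{i,j})_{i\in\mathbf N}$ is column $j$ of $M$, considered as compositions. $\operatorname{row}(M)=(\sum_jM_{i,j})_i$ and $\operatorname{col}(M)=(\sum_iM_{i,j})_j$. $\mathcal M^{[2]}_{\alpha,\beta}=\{M\in\mathcal M^{[2]}:\operatorname{row}(M)=\alpha,\ \operatorname{col}(M)=\beta\}$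 (which is empty if $\alpha$ or $\beta$ has a negative entry). $\Lambda$ is the ring of symmetric functions over $\mathbf Z$ (symmetric power series of bounded degree in indeterminates $X_i$, $i\in\mathbf N$). Schur functions: for $\alpha\in\mathbf N^n$ put $a_\alpha[X_{[n]}]=\sum_{\sigma\in\mathbf S_n}\operatorname{sgn}(\sigma)\prod_{i=0}^{n-1}X_{\sigma(i)}^{\alpha_i}$, let $\delta_n=(n-1,\ldots,1,0)$, and set $s_\alpha[X_{[n]}]=a_{\delta_n+\alpha}[X_{[n]}]/a_{\delta_n}[X_{[n]}]$ for $\alpha\in\mathbf N^n$ and $s_\alpha[X_{[n]}]=0$ for $\alpha\in\mathcal C\setminus\mathbf N^n$. Then $s_\alpha\in\Lambda$ is the unique symmetric function which for every $n$ becomes $s_\alpha[X_{[n]}]$ upon setting $X_i=0$ for all $i\ge n$. The set $\{s_\lambda:\lambda\in\mathcal P\}$ is a $\mathbf Z$-basis of $\Lambda$; $\langle\cdot,\cdot\rangle$ is the scalar product on $\Lambda$ for which this basis is orthonormal. For $\lambda,\mu\in\mathcal P$ the skew Schur function is $s_{\lambda/\mu}=s_\mu^*(s_\lambda)$, where $s_\mu^*$ is the adjoint of multiplication by $s_\mu$; i.e. $\langle s_{\lambda/\mu},f\rangle=\langle s_\lambda,s_\mu f\rangle$ for all $f\in\Lambda$ (so $s_{\lambda/\mu}=0$ unless $\mu_i\le\lambda_i$ for all $i$). *)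

theory Defs
  imports
    "HOL-Library.Poly_Mapping"
    "HOL-Combinatorics.Permutations"
begin

section \<open>Compositions and partitions\<close>

text \<open>
  A composition is a finitely supported function on the natural numbers.  The same type serves
  as the type of exponent vectors of monomials in the indeterminates $X_0, X_1, \ldots$.
\<close>

type_synonym composition = "nat \<Rightarrow>\<^sub>0 nat"

definition weight :: "composition \<Rightarrow> nat" where
  "weight \<alpha> = (\<Sum>i\<in>Poly_Mapping.keys \<alpha>. Poly_Mapping.lookup \<alpha> i)"

definition int_partitions :: "composition set" where
  "int_partitions = {\<alpha>. antimono (Poly_Mapping.lookup \<alpha>)}"

lift_definition conj_partition :: "composition \<Rightarrow> composition"
  is "\<lambda>\<alpha> j. card {i. j < \<alpha> i}"
proof -
  fix \<alpha> :: "nat \<Rightarrow> nat"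
  assume fin: "finite {i. \<alpha> i \<noteq> 0}"
  have "{j. card {i. j < \<alpha> i} \<noteq> 0} \<subseteq> (\<Union>i\<in>{i. \<alpha> i \<noteq> 0}. {..<\<alpha> i})"
  proof
    fix j assume "j \<in> {j. card {i. j < \<alpha> i} \<noteq> 0}"
    then have "{i. j < \<alpha> i} \<noteq> {}" by (auto simp del: Collect_empty_eq)
    then show "j \<in> (\<Union>i\<in>{i. \<alpha> i \<noteq> 0}. {..<\<alpha> i})" by force
  qed
  then show "finite {j. card {i. j < \<alpha> i} \<noteq> 0}"
    using fin by (meson finite_UN_I finite_lessThan finite_subset)
qed

text \<open>The entrywise difference, which may have negative entries.\<close>

definition comp_diff :: "composition \<Rightarrow> composition \<Rightarrow> nat \<Rightarrow> int" where
  "comp_diff \<alpha> \<beta> i = int (Poly_Mapping.lookup \<alpha> i) - int (Poly_Mapping.lookup \<beta> i)"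


section \<open>Binary matrices\<close>

text \<open>
  A finitely supported matrix is a finitely supported sequence of rows, each of which is a
  composition.
\<close>

type_synonym nat_matrix = "nat \<Rightarrow>\<^sub>0 composition"

abbreviation nm_row :: "nat_matrix \<Rightarrow> nat \<Rightarrow> composition" where
  "nm_row \<equiv> Poly_Mapping.lookup"

definition nm_col :: "nat_matrix \<Rightarrow> nat \<Rightarrow> composition" where
  "nm_col M j = Poly_Mapping.map (\<lambda>r. Poly_Mapping.lookup r j) M"

lemma lookup_nm_col:
  "Poly_Mapping.lookup (nm_col M j) i = Poly_Mapping.lookup (nm_row M i) j"
  by (auto simp: nm_col_def Poly_Mapping.map.rep_eq when_def)

definition binary_matrices :: "(nat \<Rightarrow> int) \<Rightarrow> (nat \<Rightarrow> int) \<Rightarrow> nat_matrix set" where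
  "binary_matrices \<alpha> \<beta> =
    {M. (\<forall>i j. Poly_Mapping.lookup (nm_row M i) j \<in> {0, 1}) \<and>
        (\<forall>i. int (weight (nm_row M i)) = \<alpha> i) \<and>
        (\<forall>j. int (weight (nm_col M j)) = \<beta> j)}"

lemma weight_eq_0_iff: "weight \<alpha> = 0 \<longleftrightarrow> \<alpha> = 0"
  by (auto simp: weight_def in_keys_iff poly_mapping_eq_iff fun_eq_iff)

lemma finite_binary_matrices:
  assumes "finite {i. \<alpha> i \<noteq> 0}" and "finite {j. \<beta> j \<noteq> 0}"
  shows "finite (binary_matrices \<alpha> \<beta>)"
proof -
  define supp where "supp = (\<lambda>M :: nat_matrix. {(i, j). Poly_Mapping.lookup (nm_row M i) j = 1})"
  have "inj_on supp (binary_matrices \<alpha> \<beta>)"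
  proof
    fix M N assume *: "M \<in> binary_matrices \<alpha> \<beta>" "N \<in> binary_matrices \<alpha> \<beta>" "supp M = supp N"
    have "Poly_Mapping.lookup (nm_row M i) j = Poly_Mapping.lookup (nm_row N i) j" for i j
    proof -
      have "(i, j) \<in> supp M \<longleftrightarrow> (i, j) \<in> supp N" using * by simp
      moreover have "Poly_Mapping.lookup (nm_row M i) j \<in> {0, 1}"
        and "Poly_Mapping.lookup (nm_row N i) j \<in> {0, 1}"
        using * unfolding binary_matrices_def by blast+
      ultimately show ?thesis by (auto simp: supp_def)
    qed
    then show "M = N" by (intro poly_mapping_eqI) auto
  qed
  moreover have "supp ` binary_matrices \<alpha> \<beta> \<subseteq> Pow ({i. \<alpha> i \<noteq> 0} \<times> {j. \<beta> j \<noteq> 0})"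
  proof (clarsimp simp: supp_def)
    fix M i j
    assume M: "M \<in> binary_matrices \<alpha> \<beta>"
      and 1: "Poly_Mapping.lookup (nm_row M i) j = Suc 0"
    have "nm_row M i \<noteq> 0" using 1 by auto
    moreover have "nm_col M j \<noteq> 0"
      using 1 lookup_nm_col[of M j i] by auto
    moreover have "\<alpha> i = int (weight (nm_row M i))" "\<beta> j = int (weight (nm_col M j))"
      using M unfolding binary_matrices_def by auto
    ultimately show "\<alpha> i \<noteq> 0 \<and> \<beta> j \<noteq> 0"
      using weight_eq_0_iff by auto
  qed
  ultimately show ?thesis
    using assms by (meson finite_Pow_iff finite_SigmaI finite_imageD finite_subset)
qed


section \<open>The ring of symmetric functions over the integers\<close>

text \<open>
  A power series is given by its coefficient function.  Symmetry is invariance under all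
  permutations of the indeterminates; since each monomial involves only finitely many of them,
  it makes no difference whether arbitrary or only finitary permutations are used.
\<close>

typedef symfun =
  "{f :: composition \<Rightarrow> int.
      (\<forall>\<pi> m. bij \<pi> \<longrightarrow> f (Poly_Mapping.map_key \<pi> m) = f m) \<and>
      (\<exists>d. \<forall>m. f m \<noteq> 0 \<longrightarrow> weight m \<le> d)}"
  morphisms sf_coeff Abs_symfun
  by (rule exI[of _ "\<lambda>_. 0"]) auto

setup_lifting type_definition_symfun

lemma finite_summands: "finite {(a, b). a + b = (m :: composition)}"
proof -
  define B where "B = (\<Union>i\<in>Poly_Mapping.keys m. {..Poly_Mapping.lookup m i})"
  define S where "S = {a. \<exists>b. a + b = m}"
  have "Poly_Mapping.lookup ` S \<subseteq>
      {f. \<forall>i. (i \<in> Poly_Mapping.keys m \<longrightarrow> f i \<in> B) \<and> (i \<notin> Poly_Mapping.keys m \<longrightarrow> f i = 0)}"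
  proof clarify
    fix a i assume "a \<in> S"
    then obtain b where "a + b = m" by (auto simp: S_def)
    then have "Poly_Mapping.lookup a i + Poly_Mapping.lookup b i = Poly_Mapping.lookup m i"
      by (metis lookup_add)
    then show "(i \<in> Poly_Mapping.keys m \<longrightarrow> Poly_Mapping.lookup a i \<in> B) \<and>
        (i \<notin> Poly_Mapping.keys m \<longrightarrow> Poly_Mapping.lookup a i = 0)"
      unfolding B_def by (metis UN_I add_is_0 atMost_iff in_keys_iff le_add1)
  qed
  moreover have "finite B" by (auto simp: B_def)
  ultimately have "finite (Poly_Mapping.lookup ` S)"
    using finite_set_of_finite_funs[of "Poly_Mapping.keys m" B 0] finite_subset finite_keys by blast
  then have "finite S"
    by (rule finite_imageD) (auto simp: inj_on_def poly_mapping_eqI)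
  moreover have "{(a, b). a + b = m} \<subseteq> (\<lambda>a. (a, m - a)) ` S"
    by (auto simp: S_def image_iff)
  ultimately show ?thesis
    by (meson finite_imageI finite_subset)
qed

lemma weight_superset:
  "finite A \<Longrightarrow> Poly_Mapping.keys a \<subseteq> A \<Longrightarrow> weight a = (\<Sum>i\<in>A. Poly_Mapping.lookup a i)"
  unfolding weight_def by (rule sum.mono_neutral_left) (auto simp: in_keys_iff)

lemma weight_add: "weight (a + b) = weight a + weight b"
proof -
  let ?A = "Poly_Mapping.keys a \<union> Poly_Mapping.keys b"
  have "weight (a + b) = (\<Sum>i\<in>?A. Poly_Mapping.lookup (a + b) i)"
    by (rule weight_superset) (auto dest: Poly_Mapping.keys_add[THEN subsetD])
  also have "\<dots> = weight a + weight b"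
    by (simp add: lookup_add sum.distrib weight_superset[of ?A])
  finally show ?thesis .
qed

definition ps_times ::
    "(composition \<Rightarrow> int) \<Rightarrow> (composition \<Rightarrow> int) \<Rightarrow> composition \<Rightarrow> int" where
  "ps_times f g m = (\<Sum>(a, b) | a + b = m. f a * g b)"

lemma ps_times_commute: "ps_times f g = ps_times g f"
  unfolding ps_times_def
  by (rule ext, rule sum.reindex_bij_witness[of _ prod.swap prod.swap])
     (auto simp: ac_simps)

lemma ps_times_assoc: "ps_times (ps_times f g) h = ps_times f (ps_times g h)"
proof
  fix m
  let ?S = "\<lambda>m. {(a, b). a + b = (m :: composition)}"
  have "ps_times (ps_times f g) h m =
      (\<Sum>x\<in>?S m. \<Sum>y\<in>?S (fst x). f (fst y) * g (snd y) * h (snd x))"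
    unfolding ps_times_def by (simp add: case_prod_beta sum_distrib_right)
  also have "\<dots> = (\<Sum>(x, y)\<in>Sigma (?S m) (\<lambda>x. ?S (fst x)). f (fst y) * g (snd y) * h (snd x))"
    by (rule sum.Sigma) (auto simp: finite_summands)
  also have "\<dots> = (\<Sum>(x, y)\<in>Sigma (?S m) (\<lambda>x. ?S (snd x)). f (fst x) * (g (fst y) * h (snd y)))"
    by (rule sum.reindex_bij_witness[of _
          "\<lambda>((a, _), (b, c)). ((a + b, c), (a, b))"
          "\<lambda>((_, c), (a, b)). ((a, b + c), (b, c))"])
       (auto simp: ac_simps)
  also have "\<dots> = (\<Sum>x\<in>?S m. \<Sum>y\<in>?S (snd x). f (fst x) * (g (fst y) * h (snd y)))"
    by (rule sum.Sigma[symmetric]) (auto simp: finite_summands)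
  also have "\<dots> = ps_times f (ps_times g h) m"
    unfolding ps_times_def by (simp add: case_prod_beta sum_distrib_left)
  finally show "ps_times (ps_times f g) h m = ps_times f (ps_times g h) m" .
qed

lemma ps_times_one: "ps_times (\<lambda>m. if m = 0 then 1 else 0) f = f"
proof
  fix m
  have "ps_times (\<lambda>m. if m = 0 then 1 else 0) f m =
      (\<Sum>x\<in>{(0 :: composition, m)}. (if fst x = 0 then 1 else 0) * f (snd x))"
    unfolding ps_times_def case_prod_beta
    by (rule sum.mono_neutral_right)
       (use finite_summands[of m] in \<open>auto simp: case_prod_unfold split: if_splits\<close>)
  then show "ps_times (\<lambda>m. if m = 0 then 1 else 0) f m = f m" by simp
qed

lemma map_key_inv:
  fixes \<pi> :: "nat \<Rightarrow> nat"
  assumes "bij \<pi>"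
  shows "Poly_Mapping.map_key (inv \<pi>) (Poly_Mapping.map_key \<pi> (a :: composition)) = a"
    and "Poly_Mapping.map_key \<pi> (Poly_Mapping.map_key (inv \<pi>) (a :: composition)) = a"
proof -
  have i: "inj \<pi>" "inj (inv \<pi>)" "surj \<pi>"
    using assms by (auto simp: bij_def intro: surj_imp_inj_inv)
  show "Poly_Mapping.map_key (inv \<pi>) (Poly_Mapping.map_key \<pi> a) = a"
    using i by (intro poly_mapping_eqI) (simp add: map_key.rep_eq surj_f_inv_f)
  show "Poly_Mapping.map_key \<pi> (Poly_Mapping.map_key (inv \<pi>) a) = a"
    using i by (intro poly_mapping_eqI) (simp add: map_key.rep_eq)
qed

lemma ps_times_symmetric:
  fixes \<pi> :: "nat \<Rightarrow> nat"
  assumes "bij \<pi>"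
    and "\<And>m. f (Poly_Mapping.map_key \<pi> m) = f m"
    and "\<And>m. g (Poly_Mapping.map_key \<pi> m) = g m"
  shows "ps_times f g (Poly_Mapping.map_key \<pi> m) = ps_times f g m"
proof -
  let ?k = "Poly_Mapping.map_key \<pi> :: composition \<Rightarrow> composition"
  let ?l = "Poly_Mapping.map_key (inv \<pi>) :: composition \<Rightarrow> composition"
  have i: "inj \<pi>" "inj (inv \<pi>)"
    using assms by (auto simp: bij_def intro: surj_imp_inj_inv)
  have "ps_times f g m = ps_times f g (?k m)"
    unfolding ps_times_def
    by (rule sum.reindex_bij_witness[of _ "map_prod ?l ?l" "map_prod ?k ?k"])
       (auto simp: map_key_plus[OF i(1), symmetric] map_key_plus[OF i(2), symmetric]
          map_key_inv[OF assms(1)] assms(2,3))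
  then show ?thesis by simp
qed

lemma ps_times_bounded:
  assumes "\<And>m. f m \<noteq> 0 \<Longrightarrow> weight m \<le> d" and "\<And>m. g m \<noteq> 0 \<Longrightarrow> weight m \<le> e"
    and "ps_times f g m \<noteq> 0"
  shows "weight m \<le> d + e"
proof -
  obtain a b where ab: "a + b = m" "f a * g b \<noteq> 0"
    using assms(3) unfolding ps_times_def by (auto elim!: sum.not_neutral_contains_not_neutral)
  then have "weight a \<le> d" "weight b \<le> e" using assms by auto
  then show ?thesis using ab by (auto simp: weight_add)
qed

lemma map_key_eq_0_iff:
  fixes \<pi> :: "nat \<Rightarrow> nat"
  assumes "bij \<pi>"
  shows "Poly_Mapping.map_key \<pi> (m :: composition) = 0 \<longleftrightarrow> m = 0"
proof
  assume "Poly_Mapping.map_key \<pi> m = 0"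
  then have "Poly_Mapping.map_key (inv \<pi>) (Poly_Mapping.map_key \<pi> m) = 0"
    using assms by (simp add: bij_def surj_imp_inj_inv)
  then show "m = 0" by (simp add: map_key_inv[OF assms])
qed (use assms in \<open>simp add: bij_def\<close>)

instantiation symfun :: comm_ring_1
begin

lift_definition zero_symfun :: symfun is "\<lambda>_. 0" by auto

lift_definition one_symfun :: symfun is "\<lambda>m. if m = 0 then 1 else 0"
  by (auto simp: map_key_eq_0_iff)

lift_definition plus_symfun :: "symfun \<Rightarrow> symfun \<Rightarrow> symfun" is "\<lambda>f g m. f m + g m"
proof (rule conjI)
  fix f g :: "composition \<Rightarrow> int"
  assume f: "(\<forall>\<pi> m. bij \<pi> \<longrightarrow> f (Poly_Mapping.map_key \<pi> m) = f m) \<and>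
      (\<exists>d. \<forall>m. f m \<noteq> 0 \<longrightarrow> weight m \<le> d)"
    and g: "(\<forall>\<pi> m. bij \<pi> \<longrightarrow> g (Poly_Mapping.map_key \<pi> m) = g m) \<and>
      (\<exists>d. \<forall>m. g m \<noteq> 0 \<longrightarrow> weight m \<le> d)"
  show "\<forall>\<pi> m. bij \<pi> \<longrightarrow> f (Poly_Mapping.map_key \<pi> m) + g (Poly_Mapping.map_key \<pi> m) = f m + g m"
    using f g by simp
  obtain d e where "\<forall>m. f m \<noteq> 0 \<longrightarrow> weight m \<le> d" "\<forall>m. g m \<noteq> 0 \<longrightarrow> weight m \<le> e"
    using f g by blast
  then have "f m + g m \<noteq> 0 \<longrightarrow> weight m \<le> max d e" for m
    by (cases "f m = 0") (auto simp: le_max_iff_disj)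
  then show "\<exists>d. \<forall>m. f m + g m \<noteq> 0 \<longrightarrow> weight m \<le> d" by blast
qed

lift_definition uminus_symfun :: "symfun \<Rightarrow> symfun" is "\<lambda>f m. - f m" by auto

definition minus_symfun :: "symfun \<Rightarrow> symfun \<Rightarrow> symfun" where
  "minus_symfun f g = f + (- g)"

lift_definition times_symfun :: "symfun \<Rightarrow> symfun \<Rightarrow> symfun" is ps_times
proof (rule conjI)
  fix f g :: "composition \<Rightarrow> int"
  assume f: "(\<forall>\<pi> m. bij \<pi> \<longrightarrow> f (Poly_Mapping.map_key \<pi> m) = f m) \<and>
      (\<exists>d. \<forall>m. f m \<noteq> 0 \<longrightarrow> weight m \<le> d)"
    and g: "(\<forall>\<pi> m. bij \<pi> \<longrightarrow> g (Poly_Mapping.map_key \<pi> m) = g m) \<and>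
      (\<exists>d. \<forall>m. g m \<noteq> 0 \<longrightarrow> weight m \<le> d)"
  show "\<forall>\<pi> m. bij \<pi> \<longrightarrow> ps_times f g (Poly_Mapping.map_key \<pi> m) = ps_times f g m"
    using f g by (auto intro: ps_times_symmetric)
  obtain d e where "\<forall>m. f m \<noteq> 0 \<longrightarrow> weight m \<le> d" "\<forall>m. g m \<noteq> 0 \<longrightarrow> weight m \<le> e"
    using f g by blast
  then show "\<exists>d. \<forall>m. ps_times f g m \<noteq> 0 \<longrightarrow> weight m \<le> d"
    using ps_times_bounded[of f d g e] by blast
qed

instance
proof
  fix a b c :: symfun
  show "a * b * c = a * (b * c)" by transfer (rule ps_times_assoc)
  show "a * b = b * a" by transfer (rule ps_times_commute)
  show "1 * a = a" by transfer (rule ps_times_one)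
  show "(a + b) * c = a * c + b * c"
    by transfer (auto simp: ps_times_def fun_eq_iff case_prod_beta distrib_right sum.distrib)
  show "a + b + c = a + (b + c)" by transfer (simp add: add.assoc)
  show "a + b = b + a" by transfer (simp add: add.commute)
  show "0 + a = a" by transfer simp
  show "- a + a = 0" by transfer simp
  show "a - b = a + (- b)" by (rule minus_symfun_def)
  show "(0 :: symfun) \<noteq> 1" by transfer (auto simp: fun_eq_iff)
qed

end


section \<open>Schur functions\<close>

text \<open>Polynomials over the integers in the indeterminates $X_0, X_1, \ldots$.\<close>

type_synonym int_mpoly = "composition \<Rightarrow>\<^sub>0 int"

definition indet :: "nat \<Rightarrow> int_mpoly" where
  "indet i = Poly_Mapping.single (Poly_Mapping.single i 1) 1"

definition alternant :: "nat \<Rightarrow> composition \<Rightarrow> int_mpoly" where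
  "alternant n \<alpha> =
    (\<Sum>\<sigma> | \<sigma> permutes {..<n}. of_int (sign \<sigma>) * (\<Prod>i<n. indet (\<sigma> i) ^ Poly_Mapping.lookup \<alpha> i))"

definition delta_comp :: "nat \<Rightarrow> composition" where
  "delta_comp n = (\<Sum>i<n. Poly_Mapping.single i (n - 1 - i))"

text \<open>
  The quotient of alternants is the unique polynomial whose product with the denominator is
  the numerator.
\<close>

definition schur_poly :: "nat \<Rightarrow> composition \<Rightarrow> int_mpoly" where
  "schur_poly n \<alpha> =
    (if Poly_Mapping.keys \<alpha> \<subseteq> {..<n}
     then (THE p. p * alternant n (delta_comp n) = alternant n (delta_comp n + \<alpha>))
     else 0)"

text \<open>The coefficients of the series obtained by setting $X_i = 0$ for all $i \ge n$.\<close>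

definition sf_restrict :: "nat \<Rightarrow> symfun \<Rightarrow> composition \<Rightarrow> int" where
  "sf_restrict n f m = (if Poly_Mapping.keys m \<subseteq> {..<n} then sf_coeff f m else 0)"

definition schur :: "composition \<Rightarrow> symfun" where
  "schur \<alpha> = (THE f. \<forall>n. sf_restrict n f = Poly_Mapping.lookup (schur_poly n \<alpha>))"


section \<open>The scalar product and skew Schur functions\<close>

text \<open>Bilinearity over the integers amounts to biadditivity.\<close>

definition sf_scalar :: "symfun \<Rightarrow> symfun \<Rightarrow> int" where
  "sf_scalar =
    (THE B. (\<forall>f g h. B (f + g) h = B f h + B g h) \<and>
            (\<forall>f g h. B f (g + h) = B f g + B f h) \<and>
            (\<forall>\<rho>\<in>int_partitions. \<forall>\<mu>\<in>int_partitions.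
               B (schur \<rho>) (schur \<mu>) = of_bool (\<rho> = \<mu>)))"

definition adjoint_mult :: "symfun \<Rightarrow> symfun \<Rightarrow> symfun" where
  "adjoint_mult h = (THE T. \<forall>f g. sf_scalar (T f) g = sf_scalar f (h * g))"

definition skew_schur :: "composition \<Rightarrow> composition \<Rightarrow> symfun" where
  "skew_schur \<rho> \<mu> = adjoint_mult (schur \<mu>) (schur \<rho>)"

end

theory Submission
  imports Defs
begin

text \<open>
  The scalar product equals $\langle s_\nu, s_\mu s_{\lambda/\kappa} \rangle$, which is the coefficient of
  $X^{\nu+\delta}$ in $s_{\lambda/\kappa} a_{\mu+\delta}$.  The coefficient of $X^\beta$ in
  $s_{\lambda/\kappa}$ is the coefficient of $s_\lambda$ in $s_\kappa h_\beta$; by the Pieri rule it counts chains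
  of horizontal strips, i.e. binary matrices with row sums $\beta$ that satisfy the first lattice condition
  for the transposed shapes.  Hence the scalar product is a signed sum over such matrices.  A matrix violating the
  second lattice condition is cancelled by a Bender-Knuth swap of two adjacent rows to the left of
  the last bad column, which transposes two entries of $\mu+\delta+\mathrm{row}(M)$; for the matrices that remain
  only the identity permutation contributes.

  The same cancellation with $\kappa=\mu=0$ identifies the generating function of such matrices with the bialternant
  quotient, so it also provides the existence of the Schur functions.
\<close>

section \<open>Restriction to finitely many indeterminates\<close>

text \<open>\<open>schur\<close>, \<open>sf_scalar\<close> and \<open>adjoint_mult\<close> are
  definite descriptions, so nothing is known about them until existence and uniqueness are settled.
  Therefore \<open>tableau_sf\<close> is built from matrices alone, and Schur and skew Schur
  functions are identified with it afterwards. No polynomial is ever divided: an antisymmetric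
  polynomial is determined by its coefficients at the strictly decreasing exponents, and products
  with alternants are compared there. The transposes come from the 0-1 entries: a horizontal strip
  has at most one cell per column, so consecutive conjugate shapes differ by a 0-1 vector, a row of
  the matrix. The swap must keep the first lattice condition, must be found again after it has been
  made, and must transpose the shifted exponent. Reversing blocks secures the first; leaving the
  columns from the last bad one on untouched secures the second; the third holds because the failure
  there is by exactly one, the step of the staircase. In the code \<open>\<rho>\<close> is the
  partition lambda of the overview.\<close>

abbreviation lk :: "('a \<Rightarrow>\<^sub>0 'b::zero) \<Rightarrow> 'a \<Rightarrow> 'b" where
  "lk \<equiv> Poly_Mapping.lookup"

abbreviation perm :: "(nat \<Rightarrow> nat) \<Rightarrow> composition \<Rightarrow> composition" where
  "perm \<equiv> Poly_Mapping.map_key"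

lemma lookup_times_ps_times:
  fixes p q :: int_mpoly
  shows "lk (p * q) m = ps_times (lk p) (lk q) m"
proof -
  have "lk (p * q) m = (\<Sum>(a, b). lk p a * lk q b when m = a + b)"
    by (simp add: times_poly_mapping.rep_eq prod_fun_unfold_prod)
  also have "\<dots> = (\<Sum>(a, b)\<in>{(a, b). a + b = m}. lk p a * lk q b when m = a + b)"
    by (rule Sum_any.expand_superset) (auto simp: finite_summands)
  also have "\<dots> = ps_times (lk p) (lk q) m"
    unfolding ps_times_def by (rule sum.cong) auto
  finally show ?thesis .
qed

lemma finite_bounded_compositions:
  "finite {m :: composition. Poly_Mapping.keys m \<subseteq> {..<n} \<and> weight m \<le> d}" (is "finite ?S")
proof -
  have "lk ` ?S \<subseteq> {f. \<forall>i. (i \<in> {..<n} \<longrightarrow> f i \<in> {..d}) \<and> (i \<notin> {..<n} \<longrightarrow> f i = 0)}"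
  proof clarify
    fix m :: composition and i
    assume m: "Poly_Mapping.keys m \<subseteq> {..<n}" "weight m \<le> d"
    have "lk m i \<le> weight m"
      unfolding weight_def by (cases "i \<in> Poly_Mapping.keys m") (auto intro: member_le_sum simp: in_keys_iff)
    then show "(i \<in> {..<n} \<longrightarrow> lk m i \<in> {..d}) \<and> (i \<notin> {..<n} \<longrightarrow> lk m i = 0)"
      using m by (auto simp: subset_iff in_keys_iff)
  qed
  then have "finite (lk ` ?S)"
    using finite_set_of_finite_funs[of "{..<n}" "{..d}" 0] finite_subset by blast
  then show ?thesis
    by (rule finite_imageD) (auto simp: inj_on_def poly_mapping_eqI)
qed

lemma sf_coeff_perm: "bij \<pi> \<Longrightarrow> sf_coeff f (perm \<pi> m) = sf_coeff f m"
  using sf_coeff[of f] by blast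

lemma sf_degree: "\<exists>d. \<forall>m. sf_coeff f m \<noteq> 0 \<longrightarrow> weight m \<le> d"
  using sf_coeff[of f] by simp

text \<open>\<open>sf_restrict\<close> is only a coefficient function. As a polynomial it lives in
  an integral domain, where a nonzero alternant can be cancelled. \<open>Abs_poly_mapping\<close>
  loses nothing, since bounded degree in n indeterminates leaves finitely many exponents.\<close>

definition sf_poly :: "nat \<Rightarrow> symfun \<Rightarrow> int_mpoly" where
  "sf_poly n f = Abs_poly_mapping (sf_restrict n f)"

lemma lookup_sf_poly: "lk (sf_poly n f) = sf_restrict n f"
proof -
  obtain d where "\<forall>m. sf_coeff f m \<noteq> 0 \<longrightarrow> weight m \<le> d" using sf_degree by blast
  then have "{m. sf_restrict n f m \<noteq> 0} \<subseteq> {m. Poly_Mapping.keys m \<subseteq> {..<n} \<and> weight m \<le> d}"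
    by (auto simp: sf_restrict_def split: if_splits)
  then have "finite {m. sf_restrict n f m \<noteq> 0}"
    using finite_bounded_compositions finite_subset by blast
  then show ?thesis unfolding sf_poly_def by simp
qed

lemma keys_add_nat: "Poly_Mapping.keys (a + b :: composition) = Poly_Mapping.keys a \<union> Poly_Mapping.keys b"
  by (auto simp: in_keys_iff lookup_add)

lemma sf_poly_add: "sf_poly n (f + g) = sf_poly n f + sf_poly n g"
  by (rule poly_mapping_eqI) (simp add: lookup_sf_poly lookup_add sf_restrict_def plus_symfun.rep_eq)

lemma sf_poly_one: "sf_poly n 1 = 1"
  by (rule poly_mapping_eqI) (auto simp: lookup_sf_poly sf_restrict_def one_symfun.rep_eq lookup_one when_def)

lemma sf_poly_times: "sf_poly n (f * g) = sf_poly n f * sf_poly n g"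
proof (rule poly_mapping_eqI)
  fix m
  show "lk (sf_poly n (f * g)) m = lk (sf_poly n f * sf_poly n g) m"
  proof (cases "Poly_Mapping.keys m \<subseteq> {..<n}")
    case True
    then show ?thesis
      by (auto simp: lookup_times_ps_times lookup_sf_poly sf_restrict_def times_symfun.rep_eq ps_times_def
          keys_add_nat intro!: sum.cong)
  next
    case False
    then have "ps_times (sf_restrict n f) (sf_restrict n g) m = 0"
      unfolding ps_times_def
      by (intro sum.neutral) (auto simp: sf_restrict_def keys_add_nat)
    then show ?thesis
      using False by (simp add: lookup_times_ps_times lookup_sf_poly sf_restrict_def)
  qed
qed

lemma lookup_of_int_times: "lk (of_int c * p :: int_mpoly) m = c * lk p m"
proof -
  have "of_int c * p = Poly_Mapping.map ((*) c) p"
    using single_of_int[of c, where ?'a = composition and ?'b = int] by (simp add: mult_map_scale_conv_mult)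
  then show ?thesis by (simp add: Poly_Mapping.map.rep_eq when_def)
qed

text \<open>Subtraction of compositions is truncated; \<open>m - c + c = m\<close> is the test that
  the monomial with exponent c divides the one with exponent m.\<close>

lemma lookup_times_single:
  fixes p :: int_mpoly
  shows "lk (p * Poly_Mapping.single c s) m = (if m - c + c = m then s * lk p (m - c) else 0)"
proof -
  have "lk (p * Poly_Mapping.single c s) m = (\<Sum>(a, b)\<in>{(a, b). a + b = m}. lk p a * (s when c = b))"
    by (simp add: lookup_times_ps_times ps_times_def lookup_single)
  also have "\<dots> = (\<Sum>(a, b)\<in>{(a, b). a + b = m \<and> b = c}. lk p a * (s when c = b))"
    by (rule sum.mono_neutral_right) (auto simp: finite_summands)
  also have "{(a, b). a + b = m \<and> b = c} = (if m - c + c = m then {(m - c, c)} else {})"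
    by auto
  finally show ?thesis by auto
qed

section \<open>Permutations acting on exponents, and the alternants\<close>

lemma lookup_perm: "bij \<sigma> \<Longrightarrow> lk (perm \<sigma> m) i = lk m (\<sigma> i)"
  by (simp add: map_key.rep_eq bij_is_inj)

lemma perm_add: "bij \<sigma> \<Longrightarrow> perm \<sigma> (a + b) = perm \<sigma> a + perm \<sigma> b"
  by (rule poly_mapping_eqI) (simp add: lookup_perm lookup_add)

lemma perm_diff: "bij \<sigma> \<Longrightarrow> perm \<sigma> (a - b) = perm \<sigma> a - perm \<sigma> b"
  by (rule poly_mapping_eqI) (simp add: lookup_perm lookup_minus)

lemma perm_perm: "bij \<sigma> \<Longrightarrow> bij \<tau> \<Longrightarrow> perm \<sigma> (perm \<tau> m) = perm (\<tau> \<circ> \<sigma>) m"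
  by (rule poly_mapping_eqI) (simp add: lookup_perm bij_comp)

lemma perm_eq_iff: "bij \<sigma> \<Longrightarrow> perm \<sigma> a = perm \<sigma> b \<longleftrightarrow> a = b"
  by (metis map_key_inv(1))

lemma perm_inv_eq_iff: "bij \<sigma> \<Longrightarrow> perm (inv \<sigma>) a = b \<longleftrightarrow> a = perm \<sigma> b"
  by (metis map_key_inv)

lemma keys_perm_subset:
  assumes "\<sigma> permutes {..<n}"
  shows "Poly_Mapping.keys (perm \<sigma> m) \<subseteq> {..<n} \<longleftrightarrow> Poly_Mapping.keys m \<subseteq> {..<n}"
proof -
  have "bij \<sigma>" using assms by (rule permutes_bij)
  have "(\<forall>i. i \<ge> n \<longrightarrow> lk m (\<sigma> i) = 0) \<longleftrightarrow> (\<forall>i. i \<ge> n \<longrightarrow> lk m i = 0)"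
    using permutes_not_in[OF assms] by (metis lessThan_iff not_less)
  moreover have "Poly_Mapping.keys a \<subseteq> {..<n} \<longleftrightarrow> (\<forall>i. i \<ge> n \<longrightarrow> lk a i = 0)" for a :: composition
    by (auto simp: subset_iff in_keys_iff) (metis not_less less_irrefl)
  ultimately show ?thesis using \<open>bij \<sigma>\<close> by (simp add: lookup_perm)
qed

lemma lookup_delta_comp: "lk (delta_comp n) i = (if i < n then n - 1 - i else 0)"
proof -
  have "lk (delta_comp n) i = (\<Sum>j<n. if i = j then n - 1 - j else 0)"
    unfolding delta_comp_def by (simp add: lookup_sum lookup_single when_def eq_commute)
  then show ?thesis by simp
qed

lemma keys_delta_comp: "Poly_Mapping.keys (delta_comp n) \<subseteq> {..<n}"
  by (auto simp: in_keys_iff lookup_delta_comp split: if_splits)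

text \<open>\<open>perm \<sigma> m\<close> is m composed with \<open>\<sigma>\<close>, while
  renaming the indeterminates by \<open>\<sigma>\<close> moves exponents the other way; hence the
  inverse.\<close>

lemma alternant_eq:
  assumes "Poly_Mapping.keys \<beta> \<subseteq> {..<n}"
  shows "alternant n \<beta> = (\<Sum>\<sigma> | \<sigma> permutes {..<n}. Poly_Mapping.single (perm (inv \<sigma>) \<beta>) (sign \<sigma>))"
  unfolding alternant_def
proof (rule sum.cong[OF refl], clarify)
  fix \<sigma> assume \<sigma>: "\<sigma> permutes {..<n}"
  then have bij: "bij \<sigma>" "bij (inv \<sigma>)" by (auto simp: permutes_bij bij_imp_bij_inv)
  have pow: "indet i ^ k = Poly_Mapping.single (Poly_Mapping.single i k) 1" for i k
    by (induction k) (simp_all add: indet_def mult_single single_add[symmetric])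
  have "(\<Prod>i\<in>A. indet (\<sigma> i) ^ lk \<beta> i) = Poly_Mapping.single (\<Sum>i\<in>A. Poly_Mapping.single (\<sigma> i) (lk \<beta> i)) 1"
    if "finite A" for A
    using that by (induction A) (simp_all add: pow mult_single)
  moreover have "(\<Sum>i<n. Poly_Mapping.single (\<sigma> i) (lk \<beta> i)) = perm (inv \<sigma>) \<beta>"
  proof (rule poly_mapping_eqI)
    fix j
    have "lk (\<Sum>i<n. Poly_Mapping.single (\<sigma> i) (lk \<beta> i)) j = (\<Sum>i<n. if i = inv \<sigma> j then lk \<beta> i else 0)"
      unfolding lookup_sum lookup_single when_def
      by (rule sum.cong) (use \<sigma> bij in \<open>auto simp: bij_inv_eq_iff\<close>)
    also have "\<dots> = lk \<beta> (inv \<sigma> j)"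
      using assms by (auto simp: subset_iff in_keys_iff)
    finally show "lk (\<Sum>i<n. Poly_Mapping.single (\<sigma> i) (lk \<beta> i)) j = lk (perm (inv \<sigma>) \<beta>) j"
      using bij by (simp add: lookup_perm)
  qed
  ultimately have "(\<Prod>i<n. indet (\<sigma> i) ^ lk \<beta> i) = Poly_Mapping.single (perm (inv \<sigma>) \<beta>) 1"
    by simp
  then show "of_int (sign \<sigma>) * (\<Prod>i<n. indet (\<sigma> i) ^ lk \<beta> i) = Poly_Mapping.single (perm (inv \<sigma>) \<beta>) (sign \<sigma>)"
    by (simp add: single_of_int[symmetric] mult_single del: single_of_int)
qed

lemma lookup_alternant:
  assumes "Poly_Mapping.keys \<beta> \<subseteq> {..<n}"
  shows "lk (alternant n \<beta>) m = (\<Sum>\<sigma> | \<sigma> permutes {..<n}. sign \<sigma> * of_bool (\<beta> = perm \<sigma> m))"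
  unfolding alternant_eq[OF assms] lookup_sum lookup_single
  by (rule sum.cong) (auto simp: perm_inv_eq_iff permutes_bij when_def)

section \<open>Antisymmetric polynomials\<close>

lemma sign_sq: "sign \<sigma> * sign \<sigma> = 1"
  by (simp add: sign_def)

text \<open>Antisymmetry in the first n places says nothing about the other places, hence the
  support condition. With both, the coefficients at strictly decreasing exponents determine the
  polynomial.\<close>

definition alternating :: "nat \<Rightarrow> int_mpoly \<Rightarrow> bool" where
  "alternating n q \<longleftrightarrow> (\<forall>m. lk q m \<noteq> 0 \<longrightarrow> Poly_Mapping.keys m \<subseteq> {..<n}) \<and>
     (\<forall>\<sigma> m. \<sigma> permutes {..<n} \<longrightarrow> lk q (perm \<sigma> m) = sign \<sigma> * lk q m)"

lemma alternating_alternant: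
  assumes "Poly_Mapping.keys \<beta> \<subseteq> {..<n}"
  shows "alternating n (alternant n \<beta>)"
  unfolding alternating_def
proof (intro conjI allI impI)
  fix m assume "lk (alternant n \<beta>) m \<noteq> 0"
  then obtain \<sigma> where "\<sigma> permutes {..<n}" "\<beta> = perm \<sigma> m"
    unfolding lookup_alternant[OF assms] by (auto elim!: sum.not_neutral_contains_not_neutral)
  then show "Poly_Mapping.keys m \<subseteq> {..<n}"
    using assms keys_perm_subset by blast
next
  fix \<tau> m assume \<tau>: "\<tau> permutes {..<n}"
  have "(\<Sum>\<sigma> | \<sigma> permutes {..<n}. sign \<sigma> * of_bool (\<beta> = perm \<sigma> m)) =
      (\<Sum>\<sigma> | \<sigma> permutes {..<n}. sign (\<tau> \<circ> \<sigma>) * of_bool (\<beta> = perm (\<tau> \<circ> \<sigma>) m))"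
    by (rule sum.reindex_bij_witness[of _ "\<lambda>\<sigma>. \<tau> \<circ> \<sigma>" "\<lambda>\<sigma>. inv \<tau> \<circ> \<sigma>"])
       (use \<tau> in \<open>auto simp: permutes_compose permutes_inv permutes_inv_o o_assoc\<close>)
  also have "\<dots> = sign \<tau> * lk (alternant n \<beta>) (perm \<tau> m)"
    unfolding lookup_alternant[OF assms] sum_distrib_left
    by (rule sum.cong) (use \<tau> in \<open>auto simp: perm_perm permutes_bij sign_compose permutes_imp_permutation[of "{..<n}"]\<close>)
  finally show "lk (alternant n \<beta>) (perm \<tau> m) = sign \<tau> * lk (alternant n \<beta>) m"
    unfolding lookup_alternant[OF assms, of m] by (simp add: mult.assoc[symmetric] sign_sq)
qed

lemma alternating_diff: "alternating n p \<Longrightarrow> alternating n q \<Longrightarrow> alternating n (p - q)"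
  unfolding alternating_def lookup_minus right_diff_distrib by (metis diff_self)

lemma alternating_sum: "(\<And>x. x \<in> A \<Longrightarrow> alternating n (q x)) \<Longrightarrow> alternating n (sum q A)"
  unfolding alternating_def lookup_sum
  by (auto simp: sum_distrib_left intro!: sum.cong) (meson subsetD sum.neutral lessThan_iff)

lemma alternating_of_int_times: "alternating n q \<Longrightarrow> alternating n (of_int c * q)"
  unfolding alternating_def lookup_of_int_times by auto

lemma alternating_sf_poly_times:
  assumes q: "alternating n q"
  shows "alternating n (sf_poly n f * q)"
  unfolding alternating_def
proof (intro conjI allI impI)
  fix m assume "lk (sf_poly n f * q) m \<noteq> 0"
  then obtain a b where "a + b = m" "lk (sf_poly n f) a \<noteq> 0" "lk q b \<noteq> 0"
    unfolding lookup_times_ps_times ps_times_def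
    by (auto elim!: sum.not_neutral_contains_not_neutral)
  then show "Poly_Mapping.keys m \<subseteq> {..<n}"
    using q unfolding alternating_def keys_add_nat
    by (metis Un_subset_iff keys_add_nat lookup_sf_poly sf_restrict_def)
next
  fix \<tau> m assume \<tau>: "\<tau> permutes {..<n}"
  then have bij: "bij \<tau>" "bij (inv \<tau>)" by (auto simp: permutes_bij bij_imp_bij_inv)
  have f: "lk (sf_poly n f) (perm \<tau> a) = lk (sf_poly n f) a" for a
    using bij \<tau> by (simp add: lookup_sf_poly sf_restrict_def keys_perm_subset sf_coeff_perm)
  have q': "lk q (perm \<tau> b) = sign \<tau> * lk q b" for b
    using q \<tau> by (simp add: alternating_def)
  have "lk (sf_poly n f * q) (perm \<tau> m) = (\<Sum>(a, b) | a + b = m. lk (sf_poly n f) (perm \<tau> a) * lk q (perm \<tau> b))"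
    unfolding lookup_times_ps_times ps_times_def
    by (rule sum.reindex_bij_witness[of _ "map_prod (perm \<tau>) (perm \<tau>)" "map_prod (perm (inv \<tau>)) (perm (inv \<tau>))"])
       (auto simp: perm_add[symmetric] bij map_key_inv)
  then show "lk (sf_poly n f * q) (perm \<tau> m) = sign \<tau> * lk (sf_poly n f * q) m"
    unfolding lookup_times_ps_times ps_times_def f q'
    by (auto simp: sum_distrib_left intro!: sum.cong)
qed

section \<open>Coefficients of antisymmetric polynomials and the Pieri rule\<close>

text \<open>With the staircase added, a partition with at most n parts becomes a strictly decreasing
  exponent vector, whose orbit under permutations of the n places is free.\<close>

abbreviation stair :: "nat \<Rightarrow> composition \<Rightarrow> composition" where
  "stair n \<rho> \<equiv> delta_comp n + \<rho>"

lemma perm_id [simp]: "perm id m = m"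
  by (rule poly_mapping_eqI) (simp add: lookup_perm)

lemma keys_subset_iff: "Poly_Mapping.keys (a :: composition) \<subseteq> {..<n} \<longleftrightarrow> (\<forall>i\<ge>n. lk a i = 0)"
  by (auto simp: subset_iff in_keys_iff) (metis not_less less_irrefl)

lemma keys_stair: "Poly_Mapping.keys \<rho> \<subseteq> {..<n} \<Longrightarrow> Poly_Mapping.keys (stair n \<rho>) \<subseteq> {..<n}"
  using keys_delta_comp by (simp add: keys_add_nat)

lemma int_partitionsD: "\<rho> \<in> int_partitions \<Longrightarrow> i \<le> j \<Longrightarrow> lk \<rho> j \<le> lk \<rho> i"
  by (auto simp: int_partitions_def antimono_def)

lemma int_partitions_iff: "\<rho> \<in> int_partitions \<longleftrightarrow> (\<forall>i. lk \<rho> (Suc i) \<le> lk \<rho> i)"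
  by (auto simp: int_partitions_def antimono_iff_le_Suc)

lemma stair_strict:
  assumes "\<rho> \<in> int_partitions" "i < j" "j < n"
  shows "lk (stair n \<rho>) j < lk (stair n \<rho>) i"
  using assms int_partitionsD[of \<rho> i j] by (simp add: lookup_add lookup_delta_comp)

lemma stair_less_iff:
  assumes "\<rho> \<in> int_partitions" "i < n" "j < n"
  shows "lk (stair n \<rho>) j < lk (stair n \<rho>) i \<longleftrightarrow> i < j"
  using assms stair_strict[of \<rho> i j n] stair_strict[of \<rho> j i n] by (cases i j rule: linorder_cases) auto

text \<open>Strict growth gives \<open>i \<le> f i\<close> counting up from 0, and the bound gives
  \<open>f i \<le> i\<close> counting down from \<open>n - 1\<close>. The lemma serves a permutation
  and, in \<open>interlacing_determinant\<close>, a choice function.\<close>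

lemma strict_mono_self_map:
  fixes f :: "nat \<Rightarrow> nat"
  assumes mono: "\<And>i j. i < j \<Longrightarrow> j < n \<Longrightarrow> f i < f j" and bound: "\<And>i. i < n \<Longrightarrow> f i < n"
    and "i < n"
  shows "f i = i"
proof (rule antisym)
  have "i < n \<Longrightarrow> i \<le> f i" for i
  proof (induction i)
    case (Suc i)
    then have "i \<le> f i" "f i < f (Suc i)" using mono by auto
    then show ?case by simp
  qed simp
  then show "i \<le> f i" using \<open>i < n\<close> .
  have "k < n \<Longrightarrow> f (n - 1 - k) \<le> n - 1 - k" for k
  proof (induction k)
    case 0
    then show ?case using bound[of "n - 1"] by simp
  next
    case (Suc k)
    then have "f (n - 1 - k) \<le> n - 1 - k" by simp
    moreover have "f (n - 1 - Suc k) < f (n - 1 - k)" using Suc.prems by (intro mono) auto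
    ultimately show ?case by simp
  qed
  from this[of "n - 1 - i"] show "f i \<le> i" using \<open>i < n\<close> by simp
qed

text \<open>Both exponents are strictly decreasing on the first n places, so \<open>\<sigma>\<close>
  is increasing there and must be the identity.\<close>

lemma perm_stair_unique:
  assumes \<sigma>: "\<sigma> permutes {..<n}" and \<rho>: "\<rho> \<in> int_partitions" "\<rho>' \<in> int_partitions"
    and eq: "perm \<sigma> (stair n \<rho>) = stair n \<rho>'"
  shows "\<sigma> = id" and "\<rho> = \<rho>'"
proof -
  have in_n: "\<sigma> i < n" if "i < n" for i
    using \<sigma> that by (metis lessThan_iff permutes_in_image)
  have lk: "lk (stair n \<rho>) (\<sigma> i) = lk (stair n \<rho>') i" for i
    using eq \<sigma> by (metis lookup_perm permutes_bij)
  have "\<sigma> i < \<sigma> j" if "i < j" "j < n" for i j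
    using stair_strict[OF \<rho>(2) that] that in_n stair_less_iff[OF \<rho>(1), of "\<sigma> i" n "\<sigma> j"] by (simp add: lk)
  then have "\<sigma> i = i" if "i < n" for i
    using strict_mono_self_map[of n \<sigma> i] in_n that by blast
  then show "\<sigma> = id"
    using permutes_not_in[OF \<sigma>] by (metis eq_id_iff lessThan_iff)
  then have "stair n \<rho> = stair n \<rho>'"
    using eq by simp
  then show "\<rho> = \<rho>'" by simp
qed

lemma perm_sort:
  assumes "Poly_Mapping.keys m \<subseteq> {..<n}"
  shows "\<exists>\<sigma>. \<sigma> permutes {..<n} \<and> perm \<sigma> m \<in> int_partitions"
proof -
  define ys where "ys = map (lk m) [0..<n]"
  define xs where "xs = rev (sort ys)"
  have "mset xs = mset ys" by (simp add: xs_def)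
  then obtain \<sigma> where "\<sigma> permutes {..<length ys}" and list: "permute_list \<sigma> ys = xs"
    by (rule mset_eq_permutation)
  then have \<sigma>: "\<sigma> permutes {..<n}" by (simp add: ys_def)
  have xs: "xs ! i = lk (perm \<sigma> m) i" if "i < n" for i
  proof -
    have "\<sigma> i < n" using \<sigma> that by (metis lessThan_iff permutes_in_image)
    then show ?thesis
      using that \<sigma> permute_list_nth[of \<sigma> ys i] list by (simp add: ys_def lookup_perm permutes_bij)
  qed
  have len: "length xs = n" by (simp add: xs_def ys_def)
  have "sorted_wrt (\<ge>) xs" by (simp add: xs_def sorted_wrt_rev)
  then have "lk (perm \<sigma> m) (Suc i) \<le> lk (perm \<sigma> m) i" if "Suc i < n" for i
    using that len sorted_wrt_nth_less[of "(\<ge>)" xs i "Suc i"] xs[of i] xs[of "Suc i"] by simp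
  moreover have "lk (perm \<sigma> m) (Suc i) = 0" if "\<not> Suc i < n" for i
    using keys_perm_subset[OF \<sigma>, of m] assms that by (simp add: keys_subset_iff)
  ultimately have "perm \<sigma> m \<in> int_partitions"
    unfolding int_partitions_iff by (metis le0)
  with \<sigma> show ?thesis by blast
qed

text \<open>Sorted, n distinct natural numbers decrease strictly, so the entry in place i is at
  least \<open>n - 1 - i\<close>. The staircase can be subtracted without truncation, and a
  partition remains.\<close>

lemma perm_sort_stair:
  assumes keys: "Poly_Mapping.keys m \<subseteq> {..<n}" and inj: "inj_on (lk m) {..<n}"
  obtains \<sigma> \<rho> where "\<sigma> permutes {..<n}" "\<rho> \<in> int_partitions" "Poly_Mapping.keys \<rho> \<subseteq> {..<n}"
    "perm \<sigma> m = stair n \<rho>"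
proof -
  obtain \<sigma> where \<sigma>: "\<sigma> permutes {..<n}" and sorted: "perm \<sigma> m \<in> int_partitions"
    using perm_sort[OF keys] by blast
  define v where "v = perm \<sigma> m"
  have bij: "bij \<sigma>" using \<sigma> by (rule permutes_bij)
  have v_dec: "lk v j < lk v i" if "i < j" "j < n" for i j
  proof -
    have "\<sigma> i < n" "\<sigma> j < n" "\<sigma> i \<noteq> \<sigma> j"
      using \<sigma> that by (auto simp: permutes_in_image[of \<sigma> "{..<n}", simplified] permutes_inj[THEN inj_eq])
    then have "lk v i \<noteq> lk v j"
      using inj by (auto simp: v_def lookup_perm[OF bij] inj_on_def)
    then show ?thesis
      using int_partitionsD[OF sorted, of i j] that by (simp add: v_def)
  qed
  have v_ge: "n - 1 - i \<le> lk v i" if "i < n" for i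
  proof -
    have "k < n \<Longrightarrow> k \<le> lk v (n - 1 - k)" for k
    proof (induction k)
      case (Suc k)
      then have "k \<le> lk v (n - 1 - k)" "lk v (n - 1 - k) < lk v (n - 1 - Suc k)"
        by (auto intro: v_dec)
      then show ?case by simp
    qed simp
    from this[of "n - 1 - i"] show ?thesis using that by simp
  qed
  have v0: "lk v i = 0" if "i \<ge> n" for i
    using keys that bij permutes_not_in[OF \<sigma>] by (auto simp: v_def lookup_perm keys_subset_iff)
  define \<rho> where "\<rho> = v - delta_comp n"
  have eq: "v = stair n \<rho>"
  proof (rule poly_mapping_eqI)
    fix i
    show "lk v i = lk (stair n \<rho>) i"
      using v_ge[of i] by (auto simp: \<rho>_def lookup_add lookup_minus lookup_delta_comp)
  qed
  have "\<rho> \<in> int_partitions"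
    unfolding int_partitions_iff
  proof
    fix i
    show "lk \<rho> (Suc i) \<le> lk \<rho> i"
    proof (cases "Suc i < n")
      case True
      then show ?thesis using v_dec[of i "Suc i"] by (simp add: \<rho>_def lookup_minus lookup_delta_comp)
    qed (simp add: \<rho>_def lookup_minus v0)
  qed
  moreover have "Poly_Mapping.keys \<rho> \<subseteq> {..<n}"
    by (simp add: keys_subset_iff \<rho>_def lookup_minus v0)
  ultimately show ?thesis using that[OF \<sigma>, of \<rho>] eq v_def by simp
qed

text \<open>An exponent with two equal entries among the first n is fixed by a transposition, so its
  coefficient equals its own negative. Any other exponent supported there is a permutation of some
  \<open>stair n \<rho>\<close>. This test takes the place of dividing by the Vandermonde
  determinant.\<close>

lemma alternating_zero:
  assumes q: "alternating n q"
    and zero: "\<And>\<rho>. \<rho> \<in> int_partitions \<Longrightarrow> Poly_Mapping.keys \<rho> \<subseteq> {..<n} \<Longrightarrow> lk q (stair n \<rho>) = 0"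
  shows "q = 0"
proof (rule poly_mapping_eqI)
  fix m
  have "lk q m = 0"
  proof (cases "Poly_Mapping.keys m \<subseteq> {..<n}")
    case keys: True
    show ?thesis
    proof (cases "inj_on (lk m) {..<n}")
      case True
      then obtain \<sigma> \<rho> where "\<sigma> permutes {..<n}" "\<rho> \<in> int_partitions" "Poly_Mapping.keys \<rho> \<subseteq> {..<n}"
        "perm \<sigma> m = stair n \<rho>"
        using perm_sort_stair[OF keys] by blast
      then have "sign \<sigma> * lk q m = 0" using q zero unfolding alternating_def by metis
      then show ?thesis by (simp add: sign_def split: if_splits)
    next
      case False
      then obtain i j where ij: "i < n" "j < n" "i \<noteq> j" "lk m i = lk m j"
        by (auto simp: inj_on_def)
      let ?t = "Transposition.transpose i j"
      have t: "?t permutes {..<n}" using ij by (intro permutes_swap_id) auto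
      have "perm ?t m = m"
        using permutes_bij[OF t] ij
        by (intro poly_mapping_eqI) (simp add: lookup_perm Transposition.transpose_def)
      then have "lk q m = - lk q m"
        using q t ij unfolding alternating_def by (metis sign_swap_id mult_minus1)
      then show ?thesis by simp
    qed
  qed (use q in \<open>auto simp: alternating_def\<close>)
  then show "lk q m = lk 0 m" by simp
qed

lemma lookup_alternant_stair:
  assumes "\<rho> \<in> int_partitions" "Poly_Mapping.keys \<rho> \<subseteq> {..<n}" "\<rho>' \<in> int_partitions"
  shows "lk (alternant n (stair n \<rho>)) (stair n \<rho>') = of_bool (\<rho> = \<rho>')"
proof -
  have "sign \<sigma> * of_bool (stair n \<rho> = perm \<sigma> (stair n \<rho>')) = (if \<sigma> = id then of_bool (\<rho> = \<rho>') else 0)"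
    if "\<sigma> permutes {..<n}" for \<sigma>
  proof (cases "stair n \<rho> = perm \<sigma> (stair n \<rho>')")
    case True
    then have "\<sigma> = id" "\<rho>' = \<rho>"
      using perm_stair_unique[OF that assms(3,1)] by simp_all
    then show ?thesis by simp
  next
    case False
    then have "\<sigma> = id \<Longrightarrow> \<rho> \<noteq> \<rho>'" by auto
    with False show ?thesis by simp
  qed
  then have "lk (alternant n (stair n \<rho>)) (stair n \<rho>') =
      (\<Sum>\<sigma> | \<sigma> permutes {..<n}. if \<sigma> = id then of_bool (\<rho> = \<rho>') else 0)"
    unfolding lookup_alternant[OF keys_stair[OF assms(2)]] by (intro sum.cong) auto
  also have "\<dots> = of_bool (\<rho> = \<rho>')"
    by (simp add: finite_permutations permutes_id)
  finally show ?thesis .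
qed

lemma alternating_expansion:
  assumes q: "alternating n q" and F: "finite F" "F \<subseteq> int_partitions" "\<And>\<rho>. \<rho> \<in> F \<Longrightarrow> Poly_Mapping.keys \<rho> \<subseteq> {..<n}"
    and supp: "\<And>\<rho>. \<rho> \<in> int_partitions \<Longrightarrow> Poly_Mapping.keys \<rho> \<subseteq> {..<n} \<Longrightarrow> lk q (stair n \<rho>) \<noteq> 0 \<Longrightarrow> \<rho> \<in> F"
  shows "q = (\<Sum>\<rho>\<in>F. of_int (lk q (stair n \<rho>)) * alternant n (stair n \<rho>))"
proof -
  let ?r = "\<Sum>\<rho>\<in>F. of_int (lk q (stair n \<rho>)) * alternant n (stair n \<rho>)"
  have "q - ?r = 0"
  proof (rule alternating_zero)
    show "alternating n (q - ?r)"
      using F by (intro alternating_diff q alternating_sum alternating_of_int_times alternating_alternant keys_stair) auto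
    fix \<rho> assume \<rho>: "\<rho> \<in> int_partitions" "Poly_Mapping.keys \<rho> \<subseteq> {..<n}"
    have "lk ?r (stair n \<rho>) = (\<Sum>\<rho>'\<in>F. lk q (stair n \<rho>') * of_bool (\<rho>' = \<rho>))"
      unfolding lookup_sum lookup_of_int_times
      by (intro sum.cong refl) (use F \<rho> in \<open>auto simp: lookup_alternant_stair\<close>)
    also have "\<dots> = lk q (stair n \<rho>)"
      using F(1) supp[OF \<rho>] by (auto simp: of_bool_def if_distrib cong: if_cong)
    finally show "lk (q - ?r) (stair n \<rho>) = 0" by (simp add: lookup_minus)
  qed
  then show ?thesis by simp
qed

definition shifted_coeff :: "symfun \<Rightarrow> composition \<Rightarrow> composition \<Rightarrow> int" where
  "shifted_coeff f v \<beta> = (if v - \<beta> + \<beta> = v then sf_coeff f (v - \<beta>) else 0)"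

text \<open>A term of the alternant shifts the exponent by a permuted \<open>\<beta>\<close>.
  Symmetry of f lets the permutation act on m instead, which leaves \<open>\<beta>\<close> fixed
  throughout the signed sum.\<close>

lemma lookup_sf_poly_times_alternant:
  assumes \<beta>: "Poly_Mapping.keys \<beta> \<subseteq> {..<n}" and m: "Poly_Mapping.keys m \<subseteq> {..<n}"
  shows "lk (sf_poly n f * alternant n \<beta>) m = (\<Sum>\<sigma> | \<sigma> permutes {..<n}. sign \<sigma> * shifted_coeff f (perm \<sigma> m) \<beta>)"
  unfolding alternant_eq[OF \<beta>] sum_distrib_left lookup_sum lookup_times_single
proof (intro sum.cong refl)
  fix \<sigma> assume "\<sigma> \<in> {\<sigma>. \<sigma> permutes {..<n}}"
  then have \<sigma>: "\<sigma> permutes {..<n}" by simp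
  then have bij: "bij \<sigma>" by (rule permutes_bij)
  let ?b = "perm (inv \<sigma>) \<beta>"
  have b: "perm \<sigma> ?b = \<beta>" by (rule map_key_inv(2)[OF bij])
  have "m - ?b + ?b = m \<longleftrightarrow> perm \<sigma> (m - ?b + ?b) = perm \<sigma> m"
    by (simp add: perm_eq_iff[OF bij])
  also have "\<dots> \<longleftrightarrow> perm \<sigma> m - \<beta> + \<beta> = perm \<sigma> m"
    by (simp add: perm_add perm_diff bij b)
  finally have iff: "m - ?b + ?b = m \<longleftrightarrow> perm \<sigma> m - \<beta> + \<beta> = perm \<sigma> m" .
  have "Poly_Mapping.keys (m - ?b) \<subseteq> {..<n}"
    using m by (auto simp: keys_subset_iff lookup_minus)
  then have "lk (sf_poly n f) (m - ?b) = sf_coeff f (perm \<sigma> (m - ?b))"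
    by (simp add: lookup_sf_poly sf_restrict_def sf_coeff_perm bij)
  then have "lk (sf_poly n f) (m - ?b) = sf_coeff f (perm \<sigma> m - \<beta>)"
    by (simp add: perm_diff bij b)
  with iff show "(if m - ?b + ?b = m then sign \<sigma> * lk (sf_poly n f) (m - ?b) else 0) =
      sign \<sigma> * shifted_coeff f (perm \<sigma> m) \<beta>"
    by (simp add: shifted_coeff_def)
qed

section \<open>Complete homogeneous functions and the Pieri rule\<close>

lemma weight_perm:
  assumes "bij \<sigma>"
  shows "weight (perm \<sigma> m) = weight m"
proof -
  have inj: "inj \<sigma>" and surj: "surj \<sigma>" using assms by (auto simp: bij_def)
  have "Poly_Mapping.keys (perm \<sigma> m) = \<sigma> -` Poly_Mapping.keys m"
    by (auto simp: in_keys_iff lookup_perm assms)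
  then have "weight (perm \<sigma> m) = (\<Sum>i\<in>\<sigma> -` Poly_Mapping.keys m. lk m (\<sigma> i))"
    by (simp add: weight_def lookup_perm assms)
  also have "\<dots> = (\<Sum>i\<in>\<sigma> ` (\<sigma> -` Poly_Mapping.keys m). lk m i)"
    using inj by (subst sum.reindex) (auto intro: inj_on_subset)
  also have "\<sigma> ` (\<sigma> -` Poly_Mapping.keys m) = Poly_Mapping.keys m"
    using surj by (simp add: surj_image_vimage_eq)
  finally show ?thesis by (simp add: weight_def)
qed

text \<open>This is the complete homogeneous symmetric function of degree r.\<close>

lift_definition complete_sf :: "nat \<Rightarrow> symfun" is "\<lambda>r m. of_bool (weight m = r)"
  by (auto simp: weight_perm of_bool_def)

text \<open>Interlacing form of a horizontal strip: no two cells of the skew diagram lie in the same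
  column.\<close>

definition hstrip :: "composition \<Rightarrow> composition \<Rightarrow> bool" where
  "hstrip \<kappa> \<rho> \<longleftrightarrow> (\<forall>i. lk \<kappa> i \<le> lk \<rho> i \<and> lk \<rho> (Suc i) \<le> lk \<kappa> i)"

text \<open>
  The signed sum is the determinant of the 0-1 matrix with entries $[K_i \le L_j]$.  If no $K_j$ lies in
  $(L_{i+1}, L_i]$ then its columns $i$ and $i+1$ coincide.
\<close>

lemma interlacing_determinant:
  fixes K L :: "nat \<Rightarrow> nat"
  assumes K: "\<And>i j. i < n \<Longrightarrow> j < n \<Longrightarrow> K j < K i \<longleftrightarrow> i < j"
    and L: "\<And>i j. i < n \<Longrightarrow> j < n \<Longrightarrow> L j < L i \<longleftrightarrow> i < j"
  shows "(\<Sum>\<sigma> | \<sigma> permutes {..<n}. sign \<sigma> * of_bool (\<forall>i<n. K i \<le> L (\<sigma> i))) =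
    of_bool (\<forall>i<n. K i \<le> L i \<and> (Suc i < n \<longrightarrow> L (Suc i) < K i))"
    (is "?S = of_bool ?R")
proof (cases "\<exists>i. Suc i < n \<and> (\<forall>j<n. \<not> (L (Suc i) < K j \<and> K j \<le> L i))")
  case True
  then obtain i where i: "Suc i < n" and eq: "\<And>j. j < n \<Longrightarrow> K j \<le> L (Suc i) \<longleftrightarrow> K j \<le> L i"
    using L[of _ "Suc _"] by (metis Suc_lessD lessI less_imp_le linorder_not_less order.trans)
  let ?t = "Transposition.transpose i (Suc i)"
  have t: "?t permutes {..<n}" using i by (intro permutes_swap_id) auto
  have Kt: "K j \<le> L (?t x) \<longleftrightarrow> K j \<le> L x" if "j < n" for j x
    using eq[OF that] by (auto simp: Transposition.transpose_def)
  have "?S = (\<Sum>\<sigma> | \<sigma> permutes {..<n}. sign (?t \<circ> \<sigma>) * of_bool (\<forall>j<n. K j \<le> L ((?t \<circ> \<sigma>) j)))"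
    by (rule sum.reindex_bij_witness[of _ "\<lambda>\<sigma>. ?t \<circ> \<sigma>" "\<lambda>\<sigma>. ?t \<circ> \<sigma>"])
       (use t in \<open>auto simp: permutes_compose o_assoc\<close>)
  also have "\<dots> = - ?S"
    unfolding sum_negf[symmetric]
    by (intro sum.cong refl)
       (use t in \<open>auto simp: Kt sign_compose sign_swap_id permutes_imp_permutation[of "{..<n}"]\<close>)
  finally have "?S = 0" by simp
  moreover have "\<not> ?R" using eq[of i] i by (metis Suc_lessD leD)
  ultimately show ?thesis by simp
next
  case False
  then have "\<forall>i. Suc i < n \<longrightarrow> (\<exists>j<n. L (Suc i) < K j \<and> K j \<le> L i)" by blast
  then obtain g where g: "\<And>i. Suc i < n \<Longrightarrow> g i < n \<and> L (Suc i) < K (g i) \<and> K (g i) \<le> L i"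
    by metis
  have R: "?R" if \<sigma>: "\<sigma> permutes {..<n}" and "\<forall>i<n. K i \<le> L (\<sigma> i)" for \<sigma>
  proof (cases n)
    case (Suc n')
    \<comment> \<open>The last index has no interval to choose from; the row that
      \<open>\<sigma>\<close> sends to it supplies a value of K that is at most
      \<open>L n'\<close>.\<close>
    obtain l where l: "l < n" "\<sigma> l = n'"
      using \<sigma> Suc by (metis lessI lessThan_iff permutes_def permutes_in_image)
    define f where "f = g(n' := l)"
    have f: "f i < n \<and> K (f i) \<le> L i" if "i < n" for i
      using g[of i] l Suc that \<open>\<forall>i<n. K i \<le> L (\<sigma> i)\<close> by (auto simp: f_def)
    have f': "L (Suc i) < K (f i)" if "Suc i < n" for i
      using g[of i] that Suc by (auto simp: f_def)
    \<comment> \<open>The chosen values lie in successive disjoint intervals, so f is increasing and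
      hence the identity: each \<open>K i\<close> lies in its own interval.\<close>
    have "f i < f j" if "i < j" "j < n" for i j
    proof -
      have "L j \<le> L (Suc i)"
        using L[of "Suc i" j] that by (cases "j = Suc i") auto
      then have "K (f j) < K (f i)"
        using f[of j] f'[of i] that by simp
      then show ?thesis using K f that by (metis less_trans)
    qed
    then have "f i = i" if "i < n" for i
      using strict_mono_self_map[of n f i] f that by blast
    then show ?thesis using f f' Suc_lessD by metis
  qed simp
  show ?thesis
  proof (cases ?R)
    case True
    have "\<sigma> = id" if \<sigma>: "\<sigma> permutes {..<n}" and K_le: "\<forall>i<n. K i \<le> L (\<sigma> i)" for \<sigma>
    \<comment> \<open>A permutation with \<open>\<sigma> i \<le> i\<close> everywhere is the
      identity; a value beyond i would give \<open>K i \<le> L (Suc i) < K i\<close>.\<close>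
    proof (rule permutes_natset_le[OF \<sigma>], clarify)
      fix i assume "i < n"
      then have "\<sigma> i < n" using \<sigma> by (metis lessThan_iff permutes_in_image)
      show "\<sigma> i \<le> i"
      proof (rule ccontr)
        assume "\<not> \<sigma> i \<le> i"
        then have "L (\<sigma> i) \<le> L (Suc i)" "Suc i < n"
          using L[of "Suc i" "\<sigma> i"] \<open>\<sigma> i < n\<close> by (cases "\<sigma> i = Suc i"; auto)+
        then show False using True K_le \<open>i < n\<close> by (metis leD le_trans)
      qed
    qed
    then have "?S = (\<Sum>\<sigma> | \<sigma> permutes {..<n}. if \<sigma> = id then 1 else 0)"
      using True by (intro sum.cong) auto
    then show ?thesis
      using True by (simp add: finite_permutations permutes_id)
  next
    case False
    then have "\<not> (\<forall>i<n. K i \<le> L (\<sigma> i))" if "\<sigma> permutes {..<n}" for \<sigma>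
      using R[OF that] by blast
    then have "?S = 0"
      by (intro sum.neutral ballI) (simp only: mem_Collect_eq of_bool_eq(1) simp_thms mult_zero_right)
    then show ?thesis using False by simp
  qed
qed

lemma diff_add_cancel_iff: "v - \<beta> + \<beta> = (v :: composition) \<longleftrightarrow> (\<forall>i. lk \<beta> i \<le> lk v i)"
  by (auto simp: poly_mapping_eq_iff fun_eq_iff lookup_add lookup_minus) (metis le_add2)

text \<open>All coefficients of a complete function in its degree are 1, so each term of the signed
  sum is a divisibility test together with a weight condition that no permutation affects. What is
  left is the interlacing determinant.\<close>

lemma pieri_coeff:
  assumes \<kappa>: "\<kappa> \<in> int_partitions" "Poly_Mapping.keys \<kappa> \<subseteq> {..<n}"
    and \<rho>: "\<rho> \<in> int_partitions" "Poly_Mapping.keys \<rho> \<subseteq> {..<n}"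
  shows "lk (sf_poly n (complete_sf r) * alternant n (stair n \<kappa>)) (stair n \<rho>) =
    of_bool (hstrip \<kappa> \<rho> \<and> weight \<rho> = weight \<kappa> + r)"
proof -
  let ?K = "lk (stair n \<kappa>)" and ?L = "lk (stair n \<rho>)"
  have sc: "shifted_coeff (complete_sf r) (perm \<sigma> (stair n \<rho>)) (stair n \<kappa>) =
      of_bool (weight \<rho> = weight \<kappa> + r) * of_bool (\<forall>i<n. ?K i \<le> ?L (\<sigma> i))"
    if \<sigma>: "\<sigma> permutes {..<n}" for \<sigma>
  proof -
    let ?v = "perm \<sigma> (stair n \<rho>)" and ?b = "stair n \<kappa>"
    have bij: "bij \<sigma>" using \<sigma> by (rule permutes_bij)
    have iff: "?v - ?b + ?b = ?v \<longleftrightarrow> (\<forall>i<n. ?K i \<le> ?L (\<sigma> i))"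
      unfolding diff_add_cancel_iff lookup_perm[OF bij]
      using keys_stair[OF \<kappa>(2)] by (auto simp: keys_subset_iff) (metis le0 not_less)
    have "weight (?v - ?b) + weight ?b = weight ?v" if "?v - ?b + ?b = ?v"
      using that by (metis weight_add)
    moreover have "weight ?v = weight (stair n \<rho>)" by (rule weight_perm[OF bij])
    ultimately have "weight (?v - ?b) = r \<longleftrightarrow> weight \<rho> = weight \<kappa> + r" if "?v - ?b + ?b = ?v"
      using that by (auto simp: weight_add)
    then show ?thesis
      by (auto simp: shifted_coeff_def complete_sf.rep_eq iff[symmetric])
  qed
  have "lk (sf_poly n (complete_sf r) * alternant n (stair n \<kappa>)) (stair n \<rho>) =
      of_bool (weight \<rho> = weight \<kappa> + r) *
      (\<Sum>\<sigma> | \<sigma> permutes {..<n}. sign \<sigma> * of_bool (\<forall>i<n. ?K i \<le> ?L (\<sigma> i)))"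
    unfolding lookup_sf_poly_times_alternant[OF keys_stair[OF \<kappa>(2)] keys_stair[OF \<rho>(2)]] sum_distrib_left
    by (intro sum.cong refl) (simp add: sc)
  also have "\<dots> = of_bool (weight \<rho> = weight \<kappa> + r) *
      of_bool (\<forall>i<n. ?K i \<le> ?L i \<and> (Suc i < n \<longrightarrow> ?L (Suc i) < ?K i))"
    by (subst interlacing_determinant) (use stair_less_iff \<kappa>(1) \<rho>(1) in auto)
  \<comment> \<open>The staircase drops by one at each step and so makes the second interlacing
    inequality strict. Nothing is demanded of it at the last index, because \<open>\<rho>\<close>
    vanishes from n on.\<close>
  also have "(\<forall>i<n. ?K i \<le> ?L i \<and> (Suc i < n \<longrightarrow> ?L (Suc i) < ?K i)) \<longleftrightarrow> hstrip \<kappa> \<rho>" (is "?A \<longleftrightarrow> _")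
  proof
    assume A: ?A
    show "hstrip \<kappa> \<rho>"
      unfolding hstrip_def
    proof
      fix i
      show "lk \<kappa> i \<le> lk \<rho> i \<and> lk \<rho> (Suc i) \<le> lk \<kappa> i"
      proof (cases "i < n")
        case True
        then have "?K i \<le> ?L i \<and> (Suc i < n \<longrightarrow> ?L (Suc i) < ?K i)" using A by blast
        moreover have "\<not> Suc i < n \<Longrightarrow> lk \<rho> (Suc i) = 0"
          using \<rho>(2) by (simp add: keys_subset_iff)
        ultimately show ?thesis
          using True by (cases "Suc i < n") (auto simp: lookup_add lookup_delta_comp)
      next
        case False
        then show ?thesis using \<kappa>(2) \<rho>(2) by (simp add: keys_subset_iff)
      qed
    qed
  next
    assume "hstrip \<kappa> \<rho>"
    then have "lk \<kappa> i \<le> lk \<rho> i" "lk \<rho> (Suc i) \<le> lk \<kappa> i" for i by (simp_all add: hstrip_def)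
    moreover have "Suc i < n \<Longrightarrow> n - 1 - Suc i + lk \<rho> (Suc i) < n - 1 - i + lk \<kappa> i" for i
      using calculation(2)[of i] by linarith
    ultimately have "?K i \<le> ?L i" "Suc i < n \<Longrightarrow> ?L (Suc i) < ?K i" if "i < n" for i
      unfolding lookup_add lookup_delta_comp using that by (simp_all add: diff_le_mono)
    then show ?A by blast
  qed
  finally show ?thesis by (simp add: of_bool_def)
qed

text \<open>Read from the larger shape downwards and for arbitrary antisymmetric Q, the Pieri rule
  becomes the recursion that removes the last strip of a chain.\<close>

lemma pieri_lookup:
  assumes Q: "alternating n Q" and \<rho>: "\<rho> \<in> int_partitions" "Poly_Mapping.keys \<rho> \<subseteq> {..<n}"
  shows "lk (sf_poly n (complete_sf r) * Q) (stair n \<rho>) =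
    (\<Sum>\<kappa> | \<kappa> \<in> int_partitions \<and> hstrip \<kappa> \<rho> \<and> weight \<rho> = weight \<kappa> + r. lk Q (stair n \<kappa>))"
proof -
  let ?T = "{\<kappa>. \<kappa> \<in> int_partitions \<and> hstrip \<kappa> \<rho> \<and> weight \<rho> = weight \<kappa> + r}"
  define F where "F = {\<kappa>. \<kappa> \<in> int_partitions \<and> Poly_Mapping.keys \<kappa> \<subseteq> {..<n} \<and> (lk Q (stair n \<kappa>) \<noteq> 0 \<or> \<kappa> \<in> ?T)}"
  have T: "Poly_Mapping.keys \<kappa> \<subseteq> {..<n}" if "hstrip \<kappa> \<rho>" for \<kappa>
    using that \<rho>(2) by (auto simp: hstrip_def keys_subset_iff) (metis le_zero_eq)
  have "finite {\<kappa>. lk Q (stair n \<kappa>) \<noteq> 0}"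
  proof (rule finite_imageD)
    show "finite (stair n ` {\<kappa>. lk Q (stair n \<kappa>) \<noteq> 0})"
      by (rule finite_subset[of _ "Poly_Mapping.keys Q"]) (auto simp: in_keys_iff)
  qed (auto simp: inj_on_def)
  moreover have "finite ?T"
    by (rule finite_subset[OF _ finite_bounded_compositions[of n "weight \<rho>"]]) (use T in auto)
  ultimately have "finite F"
    by (rule finite_subset[rotated, OF finite_UnI]) (auto simp: F_def)
  then have "Q = (\<Sum>\<kappa>\<in>F. of_int (lk Q (stair n \<kappa>)) * alternant n (stair n \<kappa>))"
    by (intro alternating_expansion[OF Q]) (auto simp: F_def)
  then have "sf_poly n (complete_sf r) * Q =
      (\<Sum>\<kappa>\<in>F. of_int (lk Q (stair n \<kappa>)) * (sf_poly n (complete_sf r) * alternant n (stair n \<kappa>)))"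
    by (metis (no_types, lifting) mult.left_commute sum.cong sum_distrib_left)
  then have "lk (sf_poly n (complete_sf r) * Q) (stair n \<rho>) =
      (\<Sum>\<kappa>\<in>F. lk Q (stair n \<kappa>) * lk (sf_poly n (complete_sf r) * alternant n (stair n \<kappa>)) (stair n \<rho>))"
    by (simp add: lookup_sum lookup_of_int_times)
  also have "\<dots> = (\<Sum>\<kappa>\<in>F. if \<kappa> \<in> ?T then lk Q (stair n \<kappa>) else 0)"
    by (intro sum.cong refl) (use \<rho> in \<open>auto simp: F_def pieri_coeff\<close>)
  also have "\<dots> = (\<Sum>\<kappa>\<in>?T. lk Q (stair n \<kappa>))"
    using \<open>finite F\<close> T by (intro sum.mono_neutral_cong_right) (auto simp: F_def)
  finally show ?thesis .
qed

section \<open>Chains of horizontal strips as binary matrices\<close>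

text \<open>For a partition the places with entry above j form an initial segment, so their number
  is also the first place outside it. Most later reasoning on conjugates uses this equivalence in
  place of cardinalities.\<close>

lemma conj_partition_galois:
  assumes "\<alpha> \<in> int_partitions"
  shows "i < lk (conj_partition \<alpha>) j \<longleftrightarrow> j < lk \<alpha> i"
proof -
  have fin: "finite {i. j < lk \<alpha> i}"
    by (rule finite_subset[of _ "Poly_Mapping.keys \<alpha>"]) (auto simp: in_keys_iff)
  have down: "i' \<in> {i. j < lk \<alpha> i}" if "i \<in> {i. j < lk \<alpha> i}" "i' \<le> i" for i i'
    using that int_partitionsD[OF assms that(2)] by simp
  obtain N where N: "{i. j < lk \<alpha> i} = {..<N}"
  proof (cases "{i. j < lk \<alpha> i} = {}")
    case False
    have "{i. j < lk \<alpha> i} = {..<Suc (Max {i. j < lk \<alpha> i})}"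
    proof (intro equalityI subsetI)
      fix i assume "i \<in> {i. j < lk \<alpha> i}"
      then have "i \<le> Max {i. j < lk \<alpha> i}" by (rule Max_ge[OF fin])
      then show "i \<in> {..<Suc (Max {i. j < lk \<alpha> i})}" by simp
    next
      fix i assume "i \<in> {..<Suc (Max {i. j < lk \<alpha> i})}"
      then have "i \<le> Max {i. j < lk \<alpha> i}" by simp
      then show "i \<in> {i. j < lk \<alpha> i}" by (rule down[OF Max_in[OF fin False]])
    qed
    then show ?thesis using that by blast
  qed (use that[of 0] in simp)
  then have "lk (conj_partition \<alpha>) j = N"
    by (simp add: conj_partition.rep_eq)
  then show ?thesis using N by blast
qed

lemma le_iff_less_imp: "(a :: nat) \<le> b \<longleftrightarrow> (\<forall>i. i < a \<longrightarrow> i < b)"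
  by (cases "a \<le> b") (auto intro: less_le_trans exI[of _ b])

lemma conj_partition_in:
  assumes "\<alpha> \<in> int_partitions"
  shows "conj_partition \<alpha> \<in> int_partitions"
  unfolding int_partitions_iff
proof
  fix j
  have "i < lk (conj_partition \<alpha>) j" if "i < lk (conj_partition \<alpha>) (Suc j)" for i
    using that conj_partition_galois[OF assms, of i] by (meson Suc_lessD)
  then show "lk (conj_partition \<alpha>) (Suc j) \<le> lk (conj_partition \<alpha>) j"
    by (meson less_irrefl not_le)
qed

lemma conj_partition_conj:
  assumes "\<alpha> \<in> int_partitions"
  shows "conj_partition (conj_partition \<alpha>) = \<alpha>"
proof (rule poly_mapping_eqI)
  fix i
  have "j < lk (conj_partition (conj_partition \<alpha>)) i \<longleftrightarrow> j < lk \<alpha> i" for j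
    using conj_partition_galois[OF assms] conj_partition_galois[OF conj_partition_in[OF assms]] by simp
  then show "lk (conj_partition (conj_partition \<alpha>)) i = lk \<alpha> i"
    by (meson le_iff_less_imp order_antisym)
qed

lemma conj_partition_eq_iff:
  "\<alpha> \<in> int_partitions \<Longrightarrow> \<beta> \<in> int_partitions \<Longrightarrow> conj_partition \<alpha> = conj_partition \<beta> \<longleftrightarrow> \<alpha> = \<beta>"
  by (metis conj_partition_conj)

lemma weight_conj_partition:
  assumes "\<alpha> \<in> int_partitions"
  shows "weight (conj_partition \<alpha>) = weight \<alpha>"
proof -
  have card: "weight \<beta> = card (Sigma (Poly_Mapping.keys \<beta>) (\<lambda>i. {..<lk \<beta> i}))" for \<beta>
    by (simp add: weight_def)
  have "(\<lambda>(i, j). (j, i)) ` Sigma (Poly_Mapping.keys \<alpha>) (\<lambda>i. {..<lk \<alpha> i}) =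
      Sigma (Poly_Mapping.keys (conj_partition \<alpha>)) (\<lambda>i. {..<lk (conj_partition \<alpha>) i})"
  proof -
    have "(\<lambda>(i, j). (j, i)) ` Sigma (Poly_Mapping.keys \<alpha>) (\<lambda>i. {..<lk \<alpha> i}) = {(j, i). j < lk \<alpha> i}"
      by (auto simp: in_keys_iff image_iff)
    also have "\<dots> = {(j, i). i < lk (conj_partition \<alpha>) j}"
      by (simp add: conj_partition_galois[OF assms])
    also have "\<dots> = Sigma (Poly_Mapping.keys (conj_partition \<alpha>)) (\<lambda>i. {..<lk (conj_partition \<alpha>) i})"
      by (auto simp: in_keys_iff)
    finally show ?thesis .
  qed
  moreover have "inj_on (\<lambda>(i, j). (j, i)) S" for S :: "(nat \<times> nat) set"
    by (auto simp: inj_on_def)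
  ultimately show ?thesis unfolding card by (metis card_image)
qed

text \<open>Conjugation turns columns of the diagram into entries; at most one cell per column
  becomes an increase by at most one at each entry. This is why chains of strips are recorded by 0-1
  rows.\<close>

lemma hstrip_conj_iff:
  assumes \<kappa>: "\<kappa> \<in> int_partitions" and \<rho>: "\<rho> \<in> int_partitions"
  shows "hstrip \<kappa> \<rho> \<longleftrightarrow> (\<forall>j. lk (conj_partition \<kappa>) j \<le> lk (conj_partition \<rho>) j \<and>
    lk (conj_partition \<rho>) j \<le> Suc (lk (conj_partition \<kappa>) j))"
proof -
  note gal = conj_partition_galois[OF \<kappa>] conj_partition_galois[OF \<rho>]
  have "(\<forall>i. lk \<kappa> i \<le> lk \<rho> i) \<longleftrightarrow> (\<forall>j. lk (conj_partition \<kappa>) j \<le> lk (conj_partition \<rho>) j)"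
    unfolding le_iff_less_imp gal by blast
  moreover have "(\<forall>i. lk \<rho> (Suc i) \<le> lk \<kappa> i) \<longleftrightarrow>
      (\<forall>j. lk (conj_partition \<rho>) j \<le> Suc (lk (conj_partition \<kappa>) j))"
  proof -
    have "a \<le> Suc b \<longleftrightarrow> (\<forall>i. Suc i < a \<longrightarrow> i < b)" for a b :: nat
      by (cases a) (auto simp: le_iff_less_imp[of _ b])
    note Suc_iff = this
    have "(\<forall>i. lk \<rho> (Suc i) \<le> lk \<kappa> i) \<longleftrightarrow> (\<forall>i j. Suc i < lk (conj_partition \<rho>) j \<longrightarrow> i < lk (conj_partition \<kappa>) j)"
      unfolding le_iff_less_imp gal by blast
    then show ?thesis unfolding Suc_iff by blast
  qed
  ultimately show ?thesis unfolding hstrip_def by blast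
qed

section \<open>Chains of shapes recorded by 0-1 matrices\<close>

abbreviation ent :: "nat_matrix \<Rightarrow> nat \<Rightarrow> nat \<Rightarrow> nat" where
  "ent M i j \<equiv> lk (nm_row M i) j"

definition row_weights :: "nat_matrix \<Rightarrow> composition" where
  "row_weights M = Poly_Mapping.map weight M"

lemma lookup_row_weights: "lk (row_weights M) i = weight (nm_row M i)"
  by (simp add: row_weights_def Poly_Mapping.map.rep_eq when_def weight_def)

text \<open>k and l are meant as conjugate shapes; row i is the difference made by step i. The
  number of steps is explicit for the sake of the induction in \<open>card_strips\<close>;
  \<open>wstrips\<close> removes it again.\<close>

definition strips :: "nat \<Rightarrow> composition \<Rightarrow> composition \<Rightarrow> nat_matrix set" where
  "strips N k l = {M. (\<forall>i j. ent M i j \<le> 1) \<and> (\<forall>i\<ge>N. nm_row M i = 0) \<and>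
     k + (\<Sum>i<N. nm_row M i) = l \<and> (\<forall>t. k + (\<Sum>i<t. nm_row M i) \<in> int_partitions)}"

definition wstrips :: "composition \<Rightarrow> composition \<Rightarrow> composition \<Rightarrow> nat_matrix set" where
  "wstrips k l \<beta> = {M. (\<exists>N. M \<in> strips N k l) \<and> row_weights M = \<beta>}"

lemma keys_bound: "\<exists>n. Poly_Mapping.keys (\<alpha> :: composition) \<subseteq> {..<n}"
  using finite_nat_set_iff_bounded[of "Poly_Mapping.keys \<alpha>"] by auto

lemma sum_rows_beyond:
  fixes M :: nat_matrix
  assumes "\<forall>i\<ge>N. nm_row M i = 0" "N \<le> N'"
  shows "(\<Sum>i<N'. nm_row M i) = (\<Sum>i<N. nm_row M i)"
  using assms by (intro sum.mono_neutral_right) auto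

lemma wstrips_eq:
  assumes "Poly_Mapping.keys \<beta> \<subseteq> {..<N}"
  shows "wstrips k l \<beta> = {M \<in> strips N k l. \<forall>i<N. weight (nm_row M i) = lk \<beta> i}"
proof (intro equalityI subsetI)
  fix M assume "M \<in> wstrips k l \<beta>"
  then obtain N' where M: "M \<in> strips N' k l" and \<beta>: "row_weights M = \<beta>"
    by (auto simp: wstrips_def)
  have row: "weight (nm_row M i) = lk \<beta> i" for i
    using \<beta> lookup_row_weights by metis
  then have "\<forall>i\<ge>N. nm_row M i = 0"
    using assms by (metis keys_subset_iff weight_eq_0_iff)
  moreover have "(\<Sum>i<N. nm_row M i) = (\<Sum>i<N'. nm_row M i)"
    using sum_rows_beyond[of N M N'] sum_rows_beyond[of N' M N] M calculation
    by (cases "N \<le> N'") (auto simp: strips_def)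
  ultimately show "M \<in> {M \<in> strips N k l. \<forall>i<N. weight (nm_row M i) = lk \<beta> i}"
    using M row by (auto simp: strips_def)
next
  fix M assume M: "M \<in> {M \<in> strips N k l. \<forall>i<N. weight (nm_row M i) = lk \<beta> i}"
  have "lk (row_weights M) i = lk \<beta> i" for i
    using M assms by (cases "i < N") (auto simp: lookup_row_weights strips_def keys_subset_iff weight_eq_0_iff)
  then have "row_weights M = \<beta>"
    by (rule poly_mapping_eqI)
  then show "M \<in> wstrips k l \<beta>"
    using M unfolding wstrips_def by blast
qed

lemma strips_Suc:
  assumes l: "l \<in> int_partitions"
  shows "{M \<in> strips (Suc N) k l. \<forall>i<Suc N. weight (nm_row M i) = lk \<beta> i} =
    (\<Union>\<tau>\<in>{\<tau> \<in> int_partitions. (\<forall>j. lk \<tau> j \<le> lk l j \<and> lk l j \<le> Suc (lk \<tau> j)) \<and> weight l = weight \<tau> + lk \<beta> N}.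
      Poly_Mapping.update N (l - \<tau>) ` {M \<in> strips N k \<tau>. \<forall>i<N. weight (nm_row M i) = lk \<beta> i})"
    (is "?A = (\<Union>\<tau>\<in>?T. ?f \<tau> ` ?B \<tau>)")
proof (intro equalityI subsetI)
  fix M assume M: "M \<in> ?A"
  define \<tau> where "\<tau> = k + (\<Sum>i<N. nm_row M i)"
  define M' where "M' = Poly_Mapping.update N 0 M"
  have l_eq: "l = \<tau> + nm_row M N" using M by (simp add: strips_def \<tau>_def add.assoc)
  have "M = ?f \<tau> M'"
    by (rule poly_mapping_eqI) (simp add: M'_def lookup_update l_eq)
  moreover have "M' \<in> ?B \<tau>"
  proof -
    have sum: "(\<Sum>i<t. nm_row M' i) = (\<Sum>i<min t N. nm_row M i)" for t
    proof -
      have "(\<Sum>i<t. nm_row M' i) = (\<Sum>i<min t N. nm_row M' i)"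
        by (rule sum.mono_neutral_right) (use M in \<open>auto simp: M'_def lookup_update strips_def\<close>)
      also have "\<dots> = (\<Sum>i<min t N. nm_row M i)"
        by (rule sum.cong) (auto simp: M'_def lookup_update)
      finally show ?thesis .
    qed
    have "ent M' i j \<le> 1" for i j
      using M by (auto simp: M'_def lookup_update strips_def)
    moreover have "\<forall>i\<ge>N. nm_row M' i = 0"
      using M by (auto simp: M'_def lookup_update strips_def)
    moreover have "weight (nm_row M' i) = lk \<beta> i" if "i < N" for i
      using M that by (auto simp: M'_def lookup_update)
    ultimately show ?thesis
      using M by (auto simp: strips_def sum \<tau>_def)
  qed
  moreover have "\<tau> \<in> ?T"
  proof -
    have "lk l j = lk \<tau> j + ent M N j" for j using l_eq by (simp add: lookup_add)
    moreover have "ent M N j \<le> 1" for j using M by (simp add: strips_def)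
    ultimately have "\<forall>j. lk \<tau> j \<le> lk l j \<and> lk l j \<le> Suc (lk \<tau> j)" by simp
    moreover have "weight l = weight \<tau> + lk \<beta> N"
      using l_eq M by (simp add: weight_add)
    moreover have "\<tau> \<in> int_partitions" using M by (simp add: strips_def \<tau>_def)
    ultimately show ?thesis by blast
  qed
  ultimately show "M \<in> (\<Union>\<tau>\<in>?T. ?f \<tau> ` ?B \<tau>)" by blast
next
  fix M assume "M \<in> (\<Union>\<tau>\<in>?T. ?f \<tau> ` ?B \<tau>)"
  then obtain \<tau> M' where \<tau>: "\<tau> \<in> ?T" and M': "M' \<in> ?B \<tau>" and M: "M = ?f \<tau> M'" by blast
  have l_eq: "\<tau> + (l - \<tau>) = l"
    using \<tau> by (intro poly_mapping_eqI) (simp add: lookup_add lookup_minus)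
  have rows: "nm_row M i = (if i = N then l - \<tau> else nm_row M' i)" for i
    by (simp add: M lookup_update)
  have sum: "k + (\<Sum>i<t. nm_row M i) = (if t \<le> N then k + (\<Sum>i<t. nm_row M' i) else l)" for t
  proof (cases "t \<le> N")
    case True
    then show ?thesis by (auto simp: rows intro!: sum.cong)
  next
    case False
    have "(\<Sum>i<t. nm_row M i) = (\<Sum>i<Suc N. nm_row M i)"
      by (rule sum.mono_neutral_right) (use False M' in \<open>auto simp: rows strips_def\<close>)
    also have "\<dots> = (\<Sum>i<N. nm_row M' i) + (l - \<tau>)"
      by (simp add: rows)
    finally show ?thesis using M' False l_eq by (simp add: strips_def add.assoc[symmetric])
  qed
  have "weight (l - \<tau>) = lk \<beta> N"
    using \<tau> l_eq weight_add[of \<tau> "l - \<tau>"] by simp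
  moreover have "lk (l - \<tau>) j \<le> 1" for j
    using \<tau> by (simp add: lookup_minus le_diff_conv)
  ultimately show "M \<in> ?A"
    using M' l unfolding strips_def mem_Collect_eq sum by (auto simp: rows less_Suc_eq)
qed

section \<open>Counting chains by products of complete functions\<close>

definition complete_prod :: "composition \<Rightarrow> symfun" where
  "complete_prod \<beta> = (\<Prod>i\<in>Poly_Mapping.keys \<beta>. complete_sf (lk \<beta> i))"

lemma complete_sf_0: "complete_sf 0 = 1"
  by transfer (auto simp: fun_eq_iff weight_eq_0_iff)

lemma complete_prod_eq:
  assumes "Poly_Mapping.keys \<beta> \<subseteq> {..<N}"
  shows "complete_prod \<beta> = (\<Prod>i<N. complete_sf (lk \<beta> i))"
  unfolding complete_prod_def using assms
  by (intro prod.mono_neutral_left) (auto simp: complete_sf_0 in_keys_iff)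

text \<open>This elementary invariance is the source of the symmetry of \<open>tableau_sf\<close>,
  which is not visible on the matrices.\<close>

lemma complete_prod_perm:
  assumes "bij \<pi>"
  shows "complete_prod (perm \<pi> \<beta>) = complete_prod \<beta>"
proof -
  have keys: "Poly_Mapping.keys (perm \<pi> \<beta>) = \<pi> -` Poly_Mapping.keys \<beta>"
    by (auto simp: in_keys_iff lookup_perm assms)
  have "complete_prod (perm \<pi> \<beta>) = (\<Prod>i\<in>\<pi> -` Poly_Mapping.keys \<beta>. complete_sf (lk \<beta> (\<pi> i)))"
    by (simp add: complete_prod_def keys lookup_perm assms)
  also have "\<dots> = (\<Prod>i\<in>\<pi> ` (\<pi> -` Poly_Mapping.keys \<beta>). complete_sf (lk \<beta> i))"
    using assms by (subst prod.reindex) (auto simp: bij_def intro: inj_on_subset)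
  also have "\<pi> ` (\<pi> -` Poly_Mapping.keys \<beta>) = Poly_Mapping.keys \<beta>"
    using assms by (simp add: surj_image_vimage_eq bij_def)
  finally show ?thesis by (simp add: complete_prod_def)
qed

lemma finite_below:
  fixes l :: composition
  shows "finite {\<tau>. (\<forall>j. lk \<tau> j \<le> lk l j) \<and> P \<tau>}"
proof -
  have "a + (l - a) = l" if "\<forall>j. lk a j \<le> lk l j" for a
    using that by (intro poly_mapping_eqI) (simp add: lookup_add lookup_minus)
  then have "{\<tau>. (\<forall>j. lk \<tau> j \<le> lk l j) \<and> P \<tau>} \<subseteq> fst ` {(a, b). a + b = l}"
    by (auto simp: image_def)
  then show ?thesis
    by (rule finite_subset) (rule finite_imageI[OF finite_summands])
qed

text \<open>Induction on the number of rows, for all \<open>\<rho>\<close> at once because peeling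
  off the last strip changes the shape. The matrices work with conjugate shapes and the Pieri rule
  with the shapes themselves, hence the two index sets \<open>T\<close> and
  \<open>T'\<close>.\<close>

lemma card_strips:
  assumes \<kappa>: "\<kappa> \<in> int_partitions" "Poly_Mapping.keys \<kappa> \<subseteq> {..<n}"
    and "\<rho> \<in> int_partitions" "Poly_Mapping.keys \<rho> \<subseteq> {..<n}"
  shows "finite {M \<in> strips N (conj_partition \<kappa>) (conj_partition \<rho>). \<forall>i<N. weight (nm_row M i) = lk \<beta> i} \<and>
    int (card {M \<in> strips N (conj_partition \<kappa>) (conj_partition \<rho>). \<forall>i<N. weight (nm_row M i) = lk \<beta> i}) =
    lk (sf_poly n (\<Prod>i<N. complete_sf (lk \<beta> i)) * alternant n (stair n \<kappa>)) (stair n \<rho>)"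
  using assms(3,4)
proof (induction N arbitrary: \<rho>)
  case 0
  have "{M \<in> strips 0 (conj_partition \<kappa>) (conj_partition \<rho>). \<forall>i<0. weight (nm_row M i) = lk \<beta> i} =
      (if \<kappa> = \<rho> then {0} else {})"
    using \<kappa>(1) 0 by (auto simp: strips_def conj_partition_in conj_partition_eq_iff intro!: poly_mapping_eqI)
  then show ?case
    using \<kappa> 0 by (auto simp: sf_poly_one lookup_alternant_stair)
next
  case (Suc N)
  let ?k = "conj_partition \<kappa>" and ?l = "conj_partition \<rho>"
  let ?B = "\<lambda>\<tau>. {M \<in> strips N ?k \<tau>. \<forall>i<N. weight (nm_row M i) = lk \<beta> i}"
  let ?f = "\<lambda>\<tau>. Poly_Mapping.update N (?l - \<tau>)"
  define T where "T = {\<tau> \<in> int_partitions. (\<forall>j. lk \<tau> j \<le> lk ?l j \<and> lk ?l j \<le> Suc (lk \<tau> j)) \<and>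
    weight ?l = weight \<tau> + lk \<beta> N}"
  define T' where "T' = {\<tau>. \<tau> \<in> int_partitions \<and> hstrip \<tau> \<rho> \<and> weight \<rho> = weight \<tau> + lk \<beta> N}"
  let ?Q = "sf_poly n (\<Prod>i<N. complete_sf (lk \<beta> i)) * alternant n (stair n \<kappa>)"
  have conj_T: "conj_partition \<tau> \<in> T' \<longleftrightarrow> \<tau> \<in> T" if "\<tau> \<in> int_partitions" for \<tau>
    using that hstrip_conj_iff[OF conj_partition_in[OF that] Suc.prems(1)]
    by (auto simp: T_def T'_def conj_partition_in conj_partition_conj weight_conj_partition Suc.prems)
  have T_sub: "\<tau> \<in> T \<Longrightarrow> \<tau> \<in> int_partitions" "\<tau> \<in> T' \<Longrightarrow> \<tau> \<in> int_partitions" for \<tau>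
    by (simp_all add: T_def T'_def)
  have conj_T': "conj_partition \<tau> \<in> T \<longleftrightarrow> \<tau> \<in> T'" if "\<tau> \<in> int_partitions" for \<tau>
    using conj_T[OF conj_partition_in[OF that]] by (simp add: conj_partition_conj[OF that])
  have keys_T': "Poly_Mapping.keys \<tau> \<subseteq> {..<n}" if "\<tau> \<in> T'" for \<tau>
    using that Suc.prems(2) by (auto simp: T'_def hstrip_def keys_subset_iff) (metis le_zero_eq)
  have IH: "finite (?B \<tau>)" "int (card (?B \<tau>)) = lk ?Q (stair n (conj_partition \<tau>))" if "\<tau> \<in> T" for \<tau>
  proof -
    have \<tau>: "\<tau> \<in> int_partitions" using that by (simp add: T_def)
    then have "conj_partition \<tau> \<in> T'" using conj_T that by simp
    from Suc.IH[OF conj_partition_in[OF \<tau>] keys_T'[OF this]]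
    show "finite (?B \<tau>)" "int (card (?B \<tau>)) = lk ?Q (stair n (conj_partition \<tau>))"
      by (simp_all add: conj_partition_conj[OF \<tau>])
  qed
  have "finite T"
    by (rule finite_subset[OF _ finite_below[of ?l "\<lambda>_. True"]]) (auto simp: T_def)
  \<comment> \<open>The intermediate shape can be read off the matrix again, so the pieces for
    different \<open>\<tau>\<close> are disjoint.\<close>
  have sum_eq: "?k + (\<Sum>i<N. nm_row (?f \<tau> M) i) = \<tau>" if "M \<in> ?B \<tau>" for M \<tau>
    using that by (simp add: strips_def lookup_update)
  have disj: "?f \<tau> ` ?B \<tau> \<inter> ?f \<tau>' ` ?B \<tau>' = {}" if "\<tau> \<noteq> \<tau>'" for \<tau> \<tau>'
  proof (rule ccontr)
    assume "\<not> ?thesis"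
    then obtain M M' where M: "M \<in> ?B \<tau>" and M': "M' \<in> ?B \<tau>'" and eq: "?f \<tau> M = ?f \<tau>' M'" by blast
    show False using that sum_eq[OF M] sum_eq[OF M'] unfolding eq by simp
  qed
  have inj: "inj_on (?f \<tau>) (?B \<tau>)" for \<tau>
  proof (rule inj_onI, rule poly_mapping_eqI)
    fix M M' i assume MM': "M \<in> ?B \<tau>" "M' \<in> ?B \<tau>" "?f \<tau> M = ?f \<tau> M'"
    show "nm_row M i = nm_row M' i"
    proof (cases "i = N")
      case True
      then show ?thesis using MM' by (simp add: strips_def)
    next
      case False
      then show ?thesis using MM'(3) by (metis lookup_update)
    qed
  qed
  have Un: "{M \<in> strips (Suc N) ?k ?l. \<forall>i<Suc N. weight (nm_row M i) = lk \<beta> i} = (\<Union>\<tau>\<in>T. ?f \<tau> ` ?B \<tau>)"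
    unfolding T_def by (rule strips_Suc[OF conj_partition_in[OF Suc.prems(1)]])
  have "card (\<Union>\<tau>\<in>T. ?f \<tau> ` ?B \<tau>) = (\<Sum>\<tau>\<in>T. card (?f \<tau> ` ?B \<tau>))"
    using \<open>finite T\<close> IH(1) disj by (intro card_UN_disjoint) auto
  then have "int (card (\<Union>\<tau>\<in>T. ?f \<tau> ` ?B \<tau>)) = (\<Sum>\<tau>\<in>T. lk ?Q (stair n (conj_partition \<tau>)))"
    by (simp add: card_image[OF inj] IH(2))
  also have "\<dots> = (\<Sum>\<tau>\<in>T'. lk ?Q (stair n \<tau>))"
    by (rule sum.reindex_bij_witness[of _ conj_partition conj_partition])
       (use conj_T conj_T' T_sub in \<open>auto simp: conj_partition_conj\<close>)
  also have "\<dots> = lk (sf_poly n (complete_sf (lk \<beta> N)) * ?Q) (stair n \<rho>)"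
    unfolding T'_def
    by (rule pieri_lookup[symmetric])
       (use Suc.prems \<kappa> in \<open>auto intro!: alternating_sf_poly_times alternating_alternant keys_stair\<close>)
  also have "sf_poly n (complete_sf (lk \<beta> N)) * ?Q = sf_poly n (\<Prod>i<Suc N. complete_sf (lk \<beta> i)) * alternant n (stair n \<kappa>)"
    by (simp add: sf_poly_times mult_ac)
  finally show ?case
    unfolding Un using \<open>finite T\<close> IH(1) by simp
qed

lemma card_wstrips:
  assumes "\<kappa> \<in> int_partitions" "Poly_Mapping.keys \<kappa> \<subseteq> {..<n}"
    and "\<rho> \<in> int_partitions" "Poly_Mapping.keys \<rho> \<subseteq> {..<n}"
  shows "int (card (wstrips (conj_partition \<kappa>) (conj_partition \<rho>) \<beta>)) =
    lk (sf_poly n (complete_prod \<beta>) * alternant n (stair n \<kappa>)) (stair n \<rho>)"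
proof -
  obtain N where N: "Poly_Mapping.keys \<beta> \<subseteq> {..<N}"
    using keys_bound by blast
  show ?thesis
    unfolding wstrips_eq[OF N] complete_prod_eq[OF N] using card_strips[OF assms] by blast
qed

lemma common_bound:
  "\<exists>n. Poly_Mapping.keys (\<alpha> :: composition) \<subseteq> {..<n} \<and> Poly_Mapping.keys (\<beta> :: composition) \<subseteq> {..<n}"
  using keys_bound[of "\<alpha> + \<beta>"] by (auto simp: keys_add_nat)

lemma weight_wstrips:
  assumes "M \<in> wstrips k l \<beta>"
  shows "weight k + weight \<beta> = weight l"
proof -
  obtain N where N: "Poly_Mapping.keys \<beta> \<subseteq> {..<N}"
    using keys_bound by blast
  then have "k + (\<Sum>i<N. nm_row M i) = l" "\<forall>i<N. weight (nm_row M i) = lk \<beta> i"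
    using assms by (auto simp: wstrips_eq strips_def)
  moreover have "weight (sum f A) = (\<Sum>i\<in>A. weight (f i))" for A :: "nat set" and f
    by (induction A rule: infinite_finite_induct) (simp_all add: weight_add, simp_all add: weight_def)
  moreover have "weight \<beta> = (\<Sum>i<N. lk \<beta> i)"
    using weight_superset[OF _ N] by simp
  ultimately show ?thesis by (auto simp: weight_add)
qed

definition skew_coeff :: "composition \<Rightarrow> composition \<Rightarrow> composition \<Rightarrow> int" where
  "skew_coeff \<rho> \<kappa> \<beta> = (if \<kappa> \<in> int_partitions \<and> \<rho> \<in> int_partitions
     then int (card (wstrips (conj_partition \<kappa>) (conj_partition \<rho>) \<beta>)) else 0)"

text \<open>The generating function of semistandard skew tableaux by content, each given as a chain
  of horizontal strips. Permuting the content permutes the factors of a product of complete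
  functions, and that product determines the count.\<close>

lift_definition tableau_sf :: "composition \<Rightarrow> composition \<Rightarrow> symfun" is skew_coeff
proof (intro conjI allI impI)
  fix \<rho> \<kappa> m :: composition and \<pi> :: "nat \<Rightarrow> nat" assume "bij \<pi>"
  obtain n where "Poly_Mapping.keys \<rho> \<subseteq> {..<n}" "Poly_Mapping.keys \<kappa> \<subseteq> {..<n}"
    using common_bound[of \<rho> \<kappa>] by blast
  then show "skew_coeff \<rho> \<kappa> (perm \<pi> m) = skew_coeff \<rho> \<kappa> m"
    using \<open>bij \<pi>\<close> by (auto simp: skew_coeff_def card_wstrips[of _ n] complete_prod_perm)
next
  fix \<rho> \<kappa> :: composition
  have "weight m \<le> weight (conj_partition \<rho>)" if "skew_coeff \<rho> \<kappa> m \<noteq> 0" for m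
  proof -
    have "wstrips (conj_partition \<kappa>) (conj_partition \<rho>) m \<noteq> {}"
      using that by (auto simp: skew_coeff_def split: if_splits)
    then show ?thesis using weight_wstrips by fastforce
  qed
  then show "\<exists>d. \<forall>m. skew_coeff \<rho> \<kappa> m \<noteq> 0 \<longrightarrow> weight m \<le> d" by blast
qed

section \<open>Cancellation of the matrices with a bad column\<close>

text \<open>In the application \<open>\<alpha>\<close> is the shape before the two rows and c counts
  the entries of both in a column. Under the assumptions of the context below, a block is an
  interval of columns and \<open>block_rev\<close> reflects it.\<close>

definition block :: "(nat \<Rightarrow> nat) \<Rightarrow> (nat \<Rightarrow> nat) \<Rightarrow> nat \<Rightarrow> nat \<Rightarrow> nat set" where
  "block \<alpha> c l j = {j'. j' < l \<and> \<alpha> j' = \<alpha> j \<and> c j' = 1}"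

definition block_rev :: "(nat \<Rightarrow> nat) \<Rightarrow> (nat \<Rightarrow> nat) \<Rightarrow> nat \<Rightarrow> nat \<Rightarrow> nat" where
  "block_rev \<alpha> c l j = (if j < l \<and> c j = 1 then Min (block \<alpha> c l j) + Max (block \<alpha> c l j) - j else j)"

context
  fixes \<alpha> c :: "nat \<Rightarrow> nat" and l :: nat
  assumes \<alpha>: "antimono \<alpha>" and \<alpha>c: "antimono (\<lambda>j. \<alpha> j + c j)"
begin

text \<open>Monotonicity of \<open>\<alpha>\<close> and of \<open>\<alpha> + c\<close> squeezes both
  functions between their values at the ends of the block, where these agree; so the block has no
  gaps.\<close>

lemma block_rev_mem:
  assumes "j < l" "c j = 1"
  shows "block_rev \<alpha> c l j \<in> block \<alpha> c l j"
proof -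
  let ?B = "block \<alpha> c l j"
  have fin: "finite ?B" and j: "j \<in> ?B" using assms by (auto simp: block_def)
  then have ne: "?B \<noteq> {}" by blast
  define r where "r = block_rev \<alpha> c l j"
  have le: "Min ?B \<le> j" "j \<le> Max ?B" using fin j by auto
  then have r: "Min ?B \<le> r" "r \<le> Max ?B" using assms by (auto simp: r_def block_rev_def)
  have ends: "Min ?B \<in> ?B" "Max ?B \<in> ?B" using fin ne by auto
  have "\<alpha> r = \<alpha> j"
    using antimonoD[OF \<alpha> r(1)] antimonoD[OF \<alpha> r(2)] ends by (simp add: block_def)
  moreover have "c r = 1"
    using antimonoD[OF \<alpha>c r(1)] antimonoD[OF \<alpha>c r(2)] ends calculation by (simp add: block_def)
  moreover have "r < l" using r ends by (simp add: block_def)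
  ultimately show ?thesis by (simp add: block_def r_def)
qed

lemma block_rev_keeps:
  "\<alpha> (block_rev \<alpha> c l j) = \<alpha> j" "c (block_rev \<alpha> c l j) = c j" "block_rev \<alpha> c l j < l \<longleftrightarrow> j < l"
  using block_rev_mem[of j] by (auto simp: block_rev_def block_def)

lemma block_rev_block_rev: "block_rev \<alpha> c l (block_rev \<alpha> c l j) = j"
proof (cases "j < l \<and> c j = 1")
  case True
  let ?B = "block \<alpha> c l j"
  have "j \<in> ?B" using True by (auto simp: block_def)
  moreover have "finite ?B" by (simp add: block_def)
  ultimately have "j \<le> Max ?B" by simp
  define i where "i = block_rev \<alpha> c l j"
  have "block \<alpha> c l i = ?B" and i: "i < l" "c i = 1"
    using True block_rev_keeps[of j] by (simp_all add: block_def i_def)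
  then have "block_rev \<alpha> c l i = Min ?B + Max ?B - i" by (simp add: block_rev_def)
  moreover have "i = Min ?B + Max ?B - j" using True by (simp add: i_def block_rev_def)
  ultimately show ?thesis using \<open>j \<le> Max ?B\<close> by (simp add: i_def)
next
  case False
  then have "block_rev \<alpha> c l j = j" by (auto simp: block_rev_def)
  then show ?thesis by simp
qed

lemma block_rev_adjacent:
  assumes "Suc j < l" "\<alpha> (Suc j) = \<alpha> j" "c j = 1" "c (Suc j) = 1"
  shows "block_rev \<alpha> c l j = Suc (block_rev \<alpha> c l (Suc j))"
proof -
  have B: "block \<alpha> c l (Suc j) = block \<alpha> c l j" using assms by (simp add: block_def)
  have "Suc j \<in> block \<alpha> c l j" using assms by (simp add: block_def)
  moreover have "finite (block \<alpha> c l j)" by (simp add: block_def)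
  ultimately have "Suc j \<le> Max (block \<alpha> c l j)" by simp
  then show ?thesis using assms B by (simp add: block_rev_def)
qed

lemma sum_block_rev: "(\<Sum>j<l. g (block_rev \<alpha> c l j)) = (\<Sum>j<l. g j :: nat)"
  by (rule sum.reindex_bij_witness[of _ "block_rev \<alpha> c l" "block_rev \<alpha> c l"])
     (auto simp: block_rev_block_rev block_rev_keeps)

text \<open>
  The Bender-Knuth involution: in each maximal run of columns where exactly one of the two rows has an
  entry and \<open>\<alpha>\<close> is constant, exchanging the rows and reversing the run turns a word
  $1^p 0^q$ into $1^q 0^p$.
\<close>

lemma antimono_block_rev:
  assumes c: "\<And>j. c j = u j + w j" and u: "\<And>j. u j \<le> 1" and w: "\<And>j. w j \<le> 1"
    and \<alpha>u: "antimono (\<lambda>j. \<alpha> j + u j)" and "u l = 0"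
  shows "antimono (\<lambda>j. \<alpha> j + (if j < l then w (block_rev \<alpha> c l j) else u j))"
  unfolding antimono_iff_le_Suc
proof
  fix j
  let ?r = "block_rev \<alpha> c l"
  have \<alpha>_Suc: "\<alpha> (Suc j) \<le> \<alpha> j" using \<alpha> by (simp add: antimono_iff_le_Suc)
  have \<alpha>u_Suc: "\<alpha> (Suc j) + u (Suc j) \<le> \<alpha> j + u j" for j using \<alpha>u by (simp add: antimono_iff_le_Suc)
  have \<alpha>c_Suc: "\<alpha> (Suc j) + c (Suc j) \<le> \<alpha> j + c j" using \<alpha>c by (simp add: antimono_iff_le_Suc)
  have w_le: "w j \<le> c j" for j by (simp add: c)
  have "\<alpha> (Suc j) + w (?r (Suc j)) \<le> \<alpha> j + w (?r j)" if "Suc j < l"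
  proof (cases "\<alpha> (Suc j) = \<alpha> j")
    case eq: True
    consider "c j = 2" | "c (Suc j) = 0" | "c j = 1" "c (Suc j) = 1"
      using u[of j] w[of j] c[of j] \<alpha>c_Suc eq by linarith
    then show ?thesis
    proof cases
      case 1
      then have "w (?r j) = 1" using c[of j] u[of j] w[of j] by (simp add: block_rev_def)
      then show ?thesis using w[of "?r (Suc j)"] eq by simp
    next
      case 2
      then have "w (?r (Suc j)) = 0" using w_le[of "Suc j"] by (simp add: block_rev_def)
      then show ?thesis using eq by simp
    next
      case 3
      let ?p = "?r (Suc j)"
      \<comment> \<open>The reflection exchanges the order of neighbours. Along the block u weakly
        decreases, and \<open>u + w = 1\<close> makes w weakly increase, so w read backwards weakly
        decreases.\<close>
      have "?r j = Suc ?p" using block_rev_adjacent that eq 3 by simp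
      moreover have "\<alpha> (?r j) = \<alpha> j" "\<alpha> ?p = \<alpha> j" "c (?r j) = 1" "c ?p = 1"
        using block_rev_keeps[of j] block_rev_keeps[of "Suc j"] eq 3 by simp_all
      ultimately have "w ?p \<le> w (?r j)"
        using \<alpha>u_Suc[of ?p] c[of ?p] c[of "?r j"] by simp
      then show ?thesis using eq by simp
    qed
  next
    case False
    then show ?thesis using \<alpha>_Suc w[of "?r (Suc j)"] by linarith
  qed
  \<comment> \<open>At the boundary the entry of column l is kept and follows a swapped one; being
    0, it cannot cause an increase.\<close>
  moreover have "\<alpha> (Suc j) + u (Suc j) \<le> \<alpha> j + w (?r j)" if "Suc j = l"
    using that \<open>u l = 0\<close> \<alpha>_Suc by simp
  ultimately show "\<alpha> (Suc j) + (if Suc j < l then w (?r (Suc j)) else u (Suc j)) \<le>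
      \<alpha> j + (if j < l then w (?r j) else u j)"
    using \<alpha>u_Suc[of j] by (cases "Suc j < l"; cases "Suc j = l") auto
qed

end

section \<open>The sign-reversing involution on matrices\<close>

definition mat_of :: "(nat \<Rightarrow> nat \<Rightarrow> nat) \<Rightarrow> nat_matrix" where
  "mat_of A = Abs_poly_mapping (\<lambda>i. Abs_poly_mapping (A i))"

lemma ent_mat_of:
  assumes "\<And>i j. A i j \<noteq> 0 \<Longrightarrow> i < n \<and> j < L"
  shows "ent (mat_of A) = A"
proof -
  have row: "lk (Abs_poly_mapping (A i)) = A i" for i
    by (rule lookup_Abs_poly_mapping, rule finite_subset[of _ "{..<L}"]) (use assms in auto)
  have "Abs_poly_mapping (A i) = 0" if "i \<ge> n" for i
    by (rule poly_mapping_eqI) (use assms[of i] that in \<open>auto simp: row not_less[symmetric]\<close>)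
  then have "{i. Abs_poly_mapping (A i) \<noteq> 0} \<subseteq> {..<n}" by (auto simp: not_less[symmetric])
  then have "finite {i. Abs_poly_mapping (A i) \<noteq> 0}" using finite_subset by blast
  then show ?thesis by (simp add: mat_of_def fun_eq_iff row)
qed

lemma nat_matrix_eqI: "ent M = ent M' \<Longrightarrow> M = M'"
  by (metis poly_mapping_eqI)

text \<open>Antisymmetry in the exponent that defines the alternant, not in the one at which it is
  evaluated; the involution acts on the former.\<close>

lemma lookup_alternant_perm:
  assumes \<tau>: "\<tau> permutes {..<n}" and \<beta>: "Poly_Mapping.keys \<beta> \<subseteq> {..<n}"
  shows "lk (alternant n (perm \<tau> \<beta>)) m = sign \<tau> * lk (alternant n \<beta>) m"
proof -
  have bij: "bij \<tau>" using \<tau> by (rule permutes_bij)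
  have \<beta>': "Poly_Mapping.keys (perm \<tau> \<beta>) \<subseteq> {..<n}" using keys_perm_subset[OF \<tau>] \<beta> by simp
  have "lk (alternant n (perm \<tau> \<beta>)) m =
      (\<Sum>\<sigma> | \<sigma> permutes {..<n}. sign (\<sigma> \<circ> \<tau>) * of_bool (perm \<tau> \<beta> = perm (\<sigma> \<circ> \<tau>) m))"
    unfolding lookup_alternant[OF \<beta>']
    by (rule sum.reindex_bij_witness[of _ "\<lambda>\<sigma>. \<sigma> \<circ> \<tau>" "\<lambda>\<sigma>. \<sigma> \<circ> inv \<tau>"])
       (use \<tau> in \<open>auto simp: permutes_compose permutes_inv permutes_inv_o o_assoc[symmetric]\<close>)
  also have "\<dots> = (\<Sum>\<sigma> | \<sigma> permutes {..<n}. sign \<tau> * (sign \<sigma> * of_bool (\<beta> = perm \<sigma> m)))"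
    by (intro sum.cong refl)
       (use \<tau> bij in \<open>auto simp: perm_perm[symmetric] perm_eq_iff permutes_bij sign_compose
          permutes_imp_permutation[of "{..<n}"]\<close>)
  finally show ?thesis unfolding lookup_alternant[OF \<beta>] sum_distrib_left .
qed

text \<open>n counts both the rows of the matrices and the indeterminates, so row weights are
  exponents. L bounds the columns, which are the places of the shapes k and l.\<close>

locale strip_matrices =
  fixes n L :: nat and k l \<mu> :: composition
  assumes keys_l: "Poly_Mapping.keys l \<subseteq> {..<L}"
    and \<mu>: "\<mu> \<in> int_partitions" "Poly_Mapping.keys \<mu> \<subseteq> {..<n}"
begin

abbreviation S :: "nat_matrix set" where
  "S \<equiv> strips n k l"

definition prefix :: "nat_matrix \<Rightarrow> nat \<Rightarrow> nat \<Rightarrow> nat" where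
  "prefix M t j = lk k j + (\<Sum>i<t. ent M i j)"

definition suffix :: "nat_matrix \<Rightarrow> nat \<Rightarrow> nat \<Rightarrow> nat" where
  "suffix M t i = lk \<mu> i + (\<Sum>j=t..<L. ent M i j)"

definition bad :: "nat_matrix \<Rightarrow> nat \<Rightarrow> nat \<Rightarrow> bool" where
  "bad M t i \<longleftrightarrow> suffix M t i < suffix M t (Suc i)"

definition good :: "nat_matrix \<Rightarrow> bool" where
  "good M \<longleftrightarrow> (\<forall>t i. \<not> bad M t i)"

text \<open>This column and the row chosen within it depend only on the columns from
  \<open>bad_col\<close> on. \<open>flip\<close> changes nothing there, so it selects the same place
  when applied again.\<close>

definition bad_col :: "nat_matrix \<Rightarrow> nat" where
  "bad_col M = (GREATEST t. \<exists>i. bad M t i)"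

definition bad_row :: "nat_matrix \<Rightarrow> nat" where
  "bad_row M = (LEAST i. bad M (bad_col M) i)"

definition row_swap :: "nat_matrix \<Rightarrow> nat \<Rightarrow> nat \<Rightarrow> nat \<Rightarrow> nat \<Rightarrow> nat" where
  "row_swap M b r i j =
    (let j' = block_rev (prefix M r) (\<lambda>j. ent M r j + ent M (Suc r) j) b j in
     if j < b \<and> i = r then ent M (Suc r) j'
     else if j < b \<and> i = Suc r then ent M r j'
     else ent M i j)"

definition flip :: "nat_matrix \<Rightarrow> nat_matrix" where
  "flip M = mat_of (row_swap M (bad_col M) (bad_row M))"

lemma S_iff:
  "M \<in> S \<longleftrightarrow> (\<forall>i j. ent M i j \<le> 1) \<and> (\<forall>i j. ent M i j \<noteq> 0 \<longrightarrow> i < n \<and> j < L) \<and>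
     (\<forall>j. prefix M n j = lk l j) \<and> (\<forall>t. antimono (prefix M t))"
    (is "_ \<longleftrightarrow> ?R")
proof -
  have lk: "lk (k + (\<Sum>i<t. nm_row M i)) = prefix M t" for t
    by (auto simp: prefix_def lookup_add lookup_sum)
  have sum: "k + (\<Sum>i<n. nm_row M i) = l \<longleftrightarrow> (\<forall>j. prefix M n j = lk l j)"
    unfolding lk[symmetric] by (simp add: poly_mapping_eq_iff fun_eq_iff)
  have rows: "(\<forall>i\<ge>n. nm_row M i = 0) \<longleftrightarrow> (\<forall>i j. ent M i j \<noteq> 0 \<longrightarrow> i < n)"
    by (auto simp: poly_mapping_eq_iff fun_eq_iff not_less[symmetric])
  have "j < L" if "\<forall>j. prefix M n j = lk l j" "ent M i j \<noteq> 0" "i < n" for i j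
  proof (rule ccontr)
    assume "\<not> j < L"
    then have "lk l j = 0" using keys_l by (simp add: keys_subset_iff)
    then have "(\<Sum>i<n. ent M i j) = 0" using that(1) by (metis add_is_0 prefix_def)
    then show False using that(2,3) by simp
  qed
  then show ?thesis
    unfolding strips_def mem_Collect_eq sum rows int_partitions_def lk by blast
qed

lemma S_entries:
  assumes "M \<in> S"
  shows "ent M i j \<le> 1" "ent M i j \<noteq> 0 \<Longrightarrow> i < n" "ent M i j \<noteq> 0 \<Longrightarrow> j < L"
    "prefix M n j = lk l j" "antimono (prefix M t)"
  using assms unfolding S_iff by simp_all

lemma finite_S: "finite S"
proof -
  define supp where "supp = (\<lambda>M :: nat_matrix. {(i, j). ent M i j = 1})"
  have "inj_on supp S"
  proof
    fix M N assume *: "M \<in> S" "N \<in> S" "supp M = supp N"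
    have "ent M i j = ent N i j" for i j
    proof -
      have "ent M i j = 1 \<longleftrightarrow> ent N i j = 1" using *(3) by (auto simp: supp_def set_eq_iff)
      moreover have "ent M i j \<le> 1" "ent N i j \<le> 1" using * by (auto simp: S_iff)
      ultimately show ?thesis by linarith
    qed
    then show "M = N" by (intro nat_matrix_eqI) auto
  qed
  moreover have "supp M \<subseteq> {..<n} \<times> {..<L}" if M: "M \<in> S" for M
  proof clarify
    fix i j assume "(i, j) \<in> supp M"
    then have "ent M i j \<noteq> 0" by (simp add: supp_def)
    then show "i \<in> {..<n} \<and> j \<in> {..<L}" using M unfolding S_iff by simp
  qed
  then have "supp ` S \<subseteq> Pow ({..<n} \<times> {..<L})" by blast
  ultimately show ?thesis
    by (meson finite_Pow_iff finite_SigmaI finite_lessThan finite_imageD finite_subset)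
qed

lemma weight_row: "M \<in> S \<Longrightarrow> weight (nm_row M i) = (\<Sum>j<L. ent M i j)"
  by (rule weight_superset) (auto simp: S_iff in_keys_iff)

lemma suffix_Suc: "t < L \<Longrightarrow> suffix M t i = ent M i t + suffix M (Suc t) i"
  by (simp add: suffix_def sum.atLeast_Suc_lessThan)

context
  fixes M assumes M: "M \<in> S" and not_good: "\<not> good M"
begin

abbreviation "b \<equiv> bad_col M"
abbreviation "r \<equiv> bad_row M"

lemma bad_less:
  assumes "bad M t i"
  shows "t < L"
proof (rule ccontr)
  assume "\<not> t < L"
  then show False
    using assms int_partitionsD[OF \<mu>(1), of i "Suc i"] by (simp add: bad_def suffix_def)
qed

lemma bad_le: "\<exists>i. bad M t i \<Longrightarrow> t \<le> L"
  using bad_less less_imp_le by blast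

lemma bad_col_row: "bad M b r"
proof -
  have "\<exists>t i. bad M t i" using not_good by (simp add: good_def)
  then have "\<exists>i. bad M b i"
    unfolding bad_col_def using GreatestI_ex_nat[of "\<lambda>t. \<exists>i. bad M t i" L] bad_le by fast
  then show ?thesis
    unfolding bad_row_def by (rule LeastI_ex)
qed

lemma bad_col_max: "bad M t i \<Longrightarrow> t \<le> b"
  unfolding bad_col_def using Greatest_le_nat[of "\<lambda>t. \<exists>i. bad M t i" t L] bad_le by fast

text \<open>The condition still holds one column further right, and a column changes each sum by at
  most one. So it fails by exactly one, with 0 directly above 1. The 0 keeps the boundary of the
  swap monotone; the excess of one is what the staircase compensates.\<close>

lemma bad_corner: "ent M r b = 0" "ent M (Suc r) b = 1" "suffix M b (Suc r) = Suc (suffix M b r)"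
proof -
  have "b < L" by (rule bad_less[OF bad_col_row])
  have "suffix M (Suc b) (Suc r) \<le> suffix M (Suc b) r"
    using bad_col_max[of "Suc b" r] unfolding bad_def by (meson Suc_n_not_le_n not_le)
  moreover have "suffix M b r < suffix M b (Suc r)" using bad_col_row by (simp add: bad_def)
  moreover have "ent M (Suc r) b \<le> 1" using S_entries(1)[OF M] .
  ultimately show "ent M r b = 0" "ent M (Suc r) b = 1" "suffix M b (Suc r) = Suc (suffix M b r)"
    using suffix_Suc[OF \<open>b < L\<close>, of M] by auto
qed

lemma Suc_bad_row: "Suc r < n"
  using bad_corner(2) S_entries(2)[OF M, of "Suc r" b] by simp

abbreviation "swap_rev \<equiv> block_rev (prefix M r) (\<lambda>j. ent M r j + ent M (Suc r) j) b"

lemma prefix_Suc: "prefix M (Suc t) j = prefix M t j + ent M t j"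
  by (simp add: prefix_def)

lemma antimono_prefix: "antimono (prefix M t)"
  using S_entries(5)[OF M] .

lemma antimono_prefix2: "antimono (\<lambda>j. prefix M r j + (ent M r j + ent M (Suc r) j))"
  using antimono_prefix[of "Suc (Suc r)"] by (simp add: prefix_Suc[abs_def] add.assoc)

lemmas rev_keeps = block_rev_keeps[OF antimono_prefix antimono_prefix2, of b]
lemmas rev_rev = block_rev_block_rev[OF antimono_prefix antimono_prefix2, of b]
lemmas sum_rev = sum_block_rev[OF antimono_prefix antimono_prefix2, of _ b]

lemma ent_flip: "ent (flip M) i j = row_swap M b r i j"
proof -
  have "i < n \<and> j < L" if "row_swap M b r i j \<noteq> 0" for i j
  proof -
  from that have "ent M i j \<noteq> 0 \<or> j < b \<and> i \<le> Suc r"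
    by (auto simp: row_swap_def Let_def split: if_splits)
  then show ?thesis
    using S_entries(2,3)[OF M, of i j] Suc_bad_row bad_less[OF bad_col_row] by auto
  qed
  then have "ent (mat_of (row_swap M b r)) = row_swap M b r"
    by (rule ent_mat_of)
  then show ?thesis unfolding flip_def by metis
qed

lemma ent_flip_simps:
  "j < b \<Longrightarrow> ent (flip M) r j = ent M (Suc r) (swap_rev j)"
  "j < b \<Longrightarrow> ent (flip M) (Suc r) j = ent M r (swap_rev j)"
  "b \<le> j \<or> i \<noteq> r \<and> i \<noteq> Suc r \<Longrightarrow> ent (flip M) i j = ent M i j"
  unfolding ent_flip by (auto simp: row_swap_def)

lemma ent_flip_pair: "ent (flip M) r j + ent (flip M) (Suc r) j = ent M r j + ent M (Suc r) j"
  using rev_keeps(2)[of j] by (cases "j < b") (simp_all add: ent_flip_simps)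

text \<open>The two rows together keep their column sums, so only the shape between them can
  change.\<close>

lemma prefix_flip: "t \<noteq> Suc r \<Longrightarrow> prefix (flip M) t j = prefix M t j"
proof (induction t)
  case (Suc t)
  show ?case
  proof (cases "t = Suc r")
    case True
    have "(\<Sum>i<r. ent (flip M) i j) = (\<Sum>i<r. ent M i j)"
      by (rule sum.cong) (auto simp: ent_flip_simps)
    then show ?thesis using True ent_flip_pair[of j] by (simp add: prefix_def)
  next
    case False
    then have "prefix (flip M) t j = prefix M t j" "ent (flip M) t j = ent M t j"
      using Suc by (auto simp: ent_flip_simps)
    then show ?thesis by (simp add: prefix_def)
  qed
qed (simp add: prefix_def)

lemma flip_in_S: "flip M \<in> S"
  unfolding S_iff
proof (intro conjI allI impI)
  fix i j
  show "ent (flip M) i j \<le> 1"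
    using S_entries(1)[OF M] by (auto simp: ent_flip row_swap_def Let_def)
  show "ent (flip M) i j \<noteq> 0 \<Longrightarrow> i < n" "ent (flip M) i j \<noteq> 0 \<Longrightarrow> j < L"
    using S_entries(2,3)[OF M, of i j] Suc_bad_row bad_less[OF bad_col_row]
    by (auto simp: ent_flip row_swap_def Let_def split: if_splits)
  show "prefix (flip M) n j = lk l j"
    using prefix_flip[of n j] Suc_bad_row S_entries(4)[OF M] by simp
next
  fix t
  show "antimono (prefix (flip M) t)"
  proof (cases "t = Suc r")
    case True
    \<comment> \<open>In \<open>antimono_block_rev\<close>, u is row r and w is row
      \<open>Suc r\<close>; the bad column takes the place of l, and the corner entry 0 supplies the
      premise on u.\<close>
    have "prefix (flip M) (Suc r) = (\<lambda>j. prefix M r j + (if j < b then ent M (Suc r) (swap_rev j) else ent M r j))"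
      using prefix_flip[of r] by (auto simp: fun_eq_iff prefix_def ent_flip_simps)
    moreover have "antimono \<dots>"
      by (rule antimono_block_rev[OF antimono_prefix antimono_prefix2])
         (use S_entries(1)[OF M] bad_corner(1) antimono_prefix[of "Suc r"] in \<open>simp_all add: prefix_Suc[abs_def]\<close>)
    ultimately show ?thesis using True by simp
  next
    case False
    then have "prefix (flip M) t = prefix M t" by (auto simp: prefix_flip)
    then show ?thesis using antimono_prefix by simp
  qed
qed

lemma suffix_flip: "b \<le> t \<Longrightarrow> suffix (flip M) t i = suffix M t i"
  by (auto simp: suffix_def ent_flip_simps intro!: sum.cong)

lemma bad_flip: "b \<le> t \<Longrightarrow> bad (flip M) t i \<longleftrightarrow> bad M t i"
  by (simp add: bad_def suffix_flip)

lemma not_good_flip: "\<not> good (flip M)"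
  using bad_col_row bad_flip by (auto simp: good_def)

lemma bad_col_flip: "bad_col (flip M) = b"
  unfolding bad_col_def[of "flip M"]
proof (rule Greatest_equality)
  show "\<exists>i. bad (flip M) b i" using bad_col_row bad_flip by blast
next
  fix t assume "\<exists>i. bad (flip M) t i"
  then show "t \<le> b" using bad_flip bad_col_max by (metis linear)
qed

lemma bad_row_flip: "bad_row (flip M) = r"
proof -
  have "bad (flip M) b = bad M b" by (rule ext) (simp add: bad_flip)
  then show ?thesis unfolding bad_row_def bad_col_flip by simp
qed

lemma flip_flip: "flip (flip M) = M"
proof (rule nat_matrix_eqI)
  have 1: "prefix (flip M) r = prefix M r" by (auto simp: prefix_flip)
  have 2: "row_swap (flip M) b r = (\<lambda>i j. ent M i j)"
    by (intro ext) (auto simp: row_swap_def Let_def 1 ent_flip_pair ent_flip_simps rev_rev rev_keeps)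
  have "ent (mat_of (ent M)) = ent M"
    by (rule ent_mat_of) (use S_entries(2,3)[OF M] in blast)
  then show "ent (flip (flip M)) = ent M"
    unfolding flip_def[of "flip M"] bad_col_flip bad_row_flip 2 .
qed

text \<open>Left of the bad column the two rows exchange their sums. From that column on,
  \<open>\<mu>\<close> included, row \<open>Suc r\<close> has one more than row r, while the
  staircase gives row r one more than row \<open>Suc r\<close>. The remaining contributions are thus
  equal, and the exchange is a transposition.\<close>

lemma row_weights_flip:
  "row_weights (flip M) + stair n \<mu> =
    perm (Transposition.transpose r (Suc r)) (row_weights M + stair n \<mu>)"
proof (rule poly_mapping_eqI)
  fix i
  have "b < L" by (rule bad_less[OF bad_col_row])
  have split: "(\<Sum>j<L. f j) = (\<Sum>j<b. f j) + (\<Sum>j=b..<L. f j)" for f :: "nat \<Rightarrow> nat"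
    using \<open>b < L\<close> by (metis atLeast0LessThan less_imp_le sum.atLeastLessThan_concat zero_le)
  have W: "weight (nm_row M i) + lk \<mu> i = (\<Sum>j<b. ent M i j) + suffix M b i" for i
    unfolding weight_row[OF M] split by (simp add: suffix_def)
  have W': "weight (nm_row (flip M) i) + lk \<mu> i = (\<Sum>j<b. ent (flip M) i j) + suffix M b i" for i
    unfolding weight_row[OF flip_in_S] split
    using suffix_flip[of b i] by (simp add: suffix_def)
  have rows: "(\<Sum>j<b. ent (flip M) r j) = (\<Sum>j<b. ent M (Suc r) j)"
    "(\<Sum>j<b. ent (flip M) (Suc r) j) = (\<Sum>j<b. ent M r j)"
    using sum_rev[of "ent M (Suc r)"] sum_rev[of "ent M r"] by (simp_all add: ent_flip_simps)
  have other: "nm_row (flip M) i = nm_row M i" if "i \<noteq> r" "i \<noteq> Suc r"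
    using that by (intro poly_mapping_eqI) (simp add: ent_flip_simps)
  have sum: "lk (row_weights N + stair n \<mu>) i = (weight (nm_row N i) + lk \<mu> i) + lk (delta_comp n) i" for N i
    by (simp add: lookup_add lookup_row_weights)
  show "lk (row_weights (flip M) + stair n \<mu>) i =
      lk (perm (Transposition.transpose r (Suc r)) (row_weights M + stair n \<mu>)) i"
    using other bad_corner(3) Suc_bad_row
    by (auto simp: lookup_perm sum W W' rows Transposition.transpose_def lookup_delta_comp lookup_row_weights)
qed

lemma keys_row_weights: "Poly_Mapping.keys (row_weights M + stair n \<mu>) \<subseteq> {..<n}"
  using keys_stair[OF \<mu>(2)] M
  by (auto simp: keys_subset_iff lookup_add lookup_row_weights weight_eq_0_iff strips_def)

lemma lookup_alternant_flip:
  "lk (alternant n (row_weights (flip M) + stair n \<mu>)) m = - lk (alternant n (row_weights M + stair n \<mu>)) m"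
  unfolding row_weights_flip
  by (subst lookup_alternant_perm) (use keys_row_weights Suc_bad_row in \<open>auto simp: permutes_swap_id sign_swap_id\<close>)

end

lemma sum_alternants:
  assumes \<nu>: "\<nu> \<in> int_partitions"
  shows "(\<Sum>M\<in>S. lk (alternant n (row_weights M + stair n \<mu>)) (stair n \<nu>)) =
    int (card {M \<in> S. good M \<and> row_weights M + \<mu> = \<nu>})"
proof -
  let ?e = "\<lambda>M. lk (alternant n (row_weights M + stair n \<mu>)) (stair n \<nu>)"
  have "(\<Sum>M | M \<in> S \<and> \<not> good M. ?e M) = (\<Sum>M | M \<in> S \<and> \<not> good M. ?e (flip M))"
    by (rule sum.reindex_bij_witness[of _ flip flip])
       (auto simp: flip_flip flip_in_S not_good_flip)
  also have "\<dots> = - (\<Sum>M | M \<in> S \<and> \<not> good M. ?e M)"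
    unfolding sum_negf[symmetric] by (rule sum.cong) (auto simp: lookup_alternant_flip)
  finally have bad: "(\<Sum>M | M \<in> S \<and> \<not> good M. ?e M) = 0" by simp
  \<comment> \<open>The suffix at column 0 is \<open>\<mu>\<close> plus the row weights, so goodness
    at \<open>t = 0\<close> already makes the exponent a shifted partition.\<close>
  have good: "?e M = of_bool (row_weights M + \<mu> = \<nu>)" if M: "M \<in> S" "good M" for M
  proof -
    have "lk (row_weights M + \<mu>) i = suffix M 0 i" for i
      using weight_row[OF M(1), of i] by (simp add: lookup_add lookup_row_weights suffix_def atLeast0LessThan)
    then have "row_weights M + \<mu> \<in> int_partitions"
      using M(2) by (simp add: int_partitions_iff good_def bad_def not_less)
    moreover have "Poly_Mapping.keys (row_weights M + \<mu>) \<subseteq> {..<n}"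
      using M(1) \<mu>(2) by (auto simp: keys_subset_iff lookup_add lookup_row_weights weight_eq_0_iff strips_def)
    ultimately show ?thesis
      using lookup_alternant_stair[of "row_weights M + \<mu>" n \<nu>] \<nu> by (simp add: add_ac)
  qed
  have "(\<Sum>M\<in>S. ?e M) = (\<Sum>M | M \<in> S \<and> good M. ?e M) + (\<Sum>M | M \<in> S \<and> \<not> good M. ?e M)"
    using finite_S by (subst sum.union_disjoint[symmetric]) (auto intro!: sum.cong)
  also have "\<dots> = (\<Sum>M | M \<in> S \<and> good M. of_bool (row_weights M + \<mu> = \<nu>))"
    unfolding bad by (simp add: good)
  also have "\<dots> = int (card {M \<in> {M. M \<in> S \<and> good M}. row_weights M + \<mu> = \<nu>})"
    using finite_S by (simp add: of_bool_def sum.If_cases Int_def)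
  finally show ?thesis by (simp add: conj_assoc)
qed

end

section \<open>Products of tableau functions with alternants\<close>

lemma wstrips_row_weights:
  assumes "Poly_Mapping.keys \<beta> \<subseteq> {..<n}"
  shows "wstrips k l \<beta> = {M \<in> strips n k l. row_weights M = \<beta>}"
  using wstrips_eq[OF assms, of k l] by (auto simp: wstrips_def)

text \<open>The coefficients of \<open>tableau_sf\<close> count matrices by row weights, so the sums
  over permutations and over matrices can be exchanged; the inner sum is then an alternant
  coefficient. The case \<open>\<kappa> = \<mu> = 0\<close> yields the Schur functions, the general
  case the theorem.\<close>

lemma lookup_tableau_sf_times_alternant:
  assumes \<kappa>: "\<kappa> \<in> int_partitions" and \<rho>: "\<rho> \<in> int_partitions"
    and \<mu>: "\<mu> \<in> int_partitions" "Poly_Mapping.keys \<mu> \<subseteq> {..<n}"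
    and \<nu>: "\<nu> \<in> int_partitions" "Poly_Mapping.keys \<nu> \<subseteq> {..<n}"
    and L: "Poly_Mapping.keys (conj_partition \<rho>) \<subseteq> {..<L}"
  shows "lk (sf_poly n (tableau_sf \<rho> \<kappa>) * alternant n (stair n \<mu>)) (stair n \<nu>) =
    int (card {M \<in> strips n (conj_partition \<kappa>) (conj_partition \<rho>).
      strip_matrices.good L \<mu> M \<and> row_weights M + \<mu> = \<nu>})"
proof -
  let ?k = "conj_partition \<kappa>" and ?l = "conj_partition \<rho>"
  let ?S = "strips n ?k ?l"
  interpret strip_matrices n L ?k ?l \<mu>
    using \<mu> L by unfold_locales
  have sc: "shifted_coeff (tableau_sf \<rho> \<kappa>) (perm \<sigma> (stair n \<nu>)) (stair n \<mu>) =
      (\<Sum>M\<in>?S. of_bool (row_weights M + stair n \<mu> = perm \<sigma> (stair n \<nu>)))"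
    if \<sigma>: "\<sigma> permutes {..<n}" for \<sigma>
  proof -
    let ?v = "perm \<sigma> (stair n \<nu>)" and ?b = "stair n \<mu>"
    have v: "Poly_Mapping.keys (?v - ?b) \<subseteq> {..<n}"
      using keys_perm_subset[OF \<sigma>, THEN iffD2, OF keys_stair[OF \<nu>(2)]] unfolding keys_subset_iff
      by (simp add: lookup_minus)
    have "(\<Sum>M\<in>?S. of_bool (row_weights M + ?b = ?v)) = int (card {M \<in> ?S. row_weights M + ?b = ?v})"
      using finite_S by (simp add: of_bool_def sum.If_cases Int_def)
    also have "\<dots> = shifted_coeff (tableau_sf \<rho> \<kappa>) ?v ?b"
    proof (cases "?v - ?b + ?b = ?v")
      case True
      then have "row_weights M + ?b = ?v \<longleftrightarrow> row_weights M = ?v - ?b" for M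
        by (metis add_right_cancel)
      then show ?thesis
        using True \<kappa> \<rho> by (simp add: shifted_coeff_def tableau_sf.rep_eq skew_coeff_def wstrips_row_weights[OF v])
    next
      case False
      then have "row_weights M + ?b \<noteq> ?v" for M by (metis add_diff_cancel_right')
      then have "{M \<in> ?S. row_weights M + ?b = ?v} = {}" by blast
      then have "card {M \<in> ?S. row_weights M + ?b = ?v} = 0" by (simp only: card.empty)
      then show ?thesis using False unfolding shifted_coeff_def by simp
    qed
    finally show ?thesis by simp
  qed
  have keys: "Poly_Mapping.keys (row_weights M + stair n \<mu>) \<subseteq> {..<n}" if "M \<in> ?S" for M
    using keys_stair[OF \<mu>(2)] that
    by (auto simp: keys_subset_iff lookup_add lookup_row_weights weight_eq_0_iff strips_def)
  have "lk (sf_poly n (tableau_sf \<rho> \<kappa>) * alternant n (stair n \<mu>)) (stair n \<nu>) =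
      (\<Sum>\<sigma> | \<sigma> permutes {..<n}. \<Sum>M\<in>?S. sign \<sigma> * of_bool (row_weights M + stair n \<mu> = perm \<sigma> (stair n \<nu>)))"
    unfolding lookup_sf_poly_times_alternant[OF keys_stair[OF \<mu>(2)] keys_stair[OF \<nu>(2)]]
    by (intro sum.cong refl) (simp add: sc sum_distrib_left)
  also have "\<dots> = (\<Sum>M\<in>?S. lk (alternant n (row_weights M + stair n \<mu>)) (stair n \<nu>))"
    by (subst sum.swap) (simp add: lookup_alternant[OF keys])
  also have "\<dots> = int (card {M \<in> ?S. good M \<and> row_weights M + \<mu> = \<nu>})"
    by (rule sum_alternants[OF \<nu>(1)])
  finally show ?thesis .
qed

section \<open>Schur functions and the scalar product\<close>

lemma conj_partition_0 [simp]: "conj_partition 0 = 0"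
  by (rule poly_mapping_eqI) (simp add: conj_partition.rep_eq)

lemma zero_int_partitions [simp]: "0 \<in> int_partitions"
  by (simp add: int_partitions_iff)

lemma binary_partition_entries:
  assumes \<alpha>: "\<alpha> \<in> int_partitions" and le: "\<And>j. lk \<alpha> j \<le> 1"
  shows "lk \<alpha> j = of_bool (j < weight \<alpha>)"
proof -
  let ?c = "conj_partition \<alpha>"
  have gal: "j < lk ?c i \<longleftrightarrow> i < lk \<alpha> j" for i j by (rule conj_partition_galois[OF \<alpha>])
  have "lk ?c i = 0" if "i \<noteq> 0" for i
    using gal[of 0 i] le[of 0] that by (cases "lk ?c i") auto
  then have "Poly_Mapping.keys ?c \<subseteq> {0}" by (auto simp: in_keys_iff)
  then have "weight ?c = lk ?c 0"
    using weight_superset[of "{0}" ?c] by simp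
  then have "j < weight \<alpha> \<longleftrightarrow> 0 < lk \<alpha> j"
    using gal[of j 0] weight_conj_partition[OF \<alpha>] by simp
  then show ?thesis using le[of j] by auto
qed

lemma sum_of_bool_less: "(\<Sum>j<L. of_bool (j < a)) = (min L a :: nat)"
proof -
  have "(\<Sum>j<L. of_bool (j < a)) = card ({..<L} \<inter> {..<a})"
    by (simp add: of_bool_def sum.If_cases lessThan_def)
  also have "{..<L} \<inter> {..<a} = {..<min L a}" by auto
  finally show ?thesis by simp
qed

lemma sum_conj_partition:
  assumes "Poly_Mapping.keys \<nu> \<subseteq> {..<n}"
  shows "(\<Sum>i<n. of_bool (j < lk \<nu> i)) = lk (conj_partition \<nu>) j"
proof -
  have "{i. j < lk \<nu> i} = {..<n} \<inter> {i. j < lk \<nu> i}"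
    using assms by (auto simp: keys_subset_iff) (metis less_zeroE not_le_imp_less)
  then show ?thesis by (simp add: conj_partition.rep_eq of_bool_def sum.If_cases)
qed

text \<open>
  The two lattice conditions force the matrix to be the Young diagram of \<open>\<nu>\<close>.
\<close>

lemma card_straight_shape:
  assumes \<rho>: "\<rho> \<in> int_partitions" and \<nu>: "\<nu> \<in> int_partitions" "Poly_Mapping.keys \<nu> \<subseteq> {..<n}"
    and L: "Poly_Mapping.keys (conj_partition \<rho>) \<subseteq> {..<L}"
  shows "card {M \<in> strips n 0 (conj_partition \<rho>). strip_matrices.good L 0 M \<and> row_weights M = \<nu>} =
    of_bool (\<rho> = \<nu>)"
proof -
  let ?l = "conj_partition \<rho>"
  interpret strip_matrices n L 0 ?l 0
    using L by unfold_locales simp_all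
  define Y where "Y = (\<lambda>i j. of_bool (j < lk \<nu> i) :: nat)"
  have diagram: "ent M = Y \<and> \<rho> = \<nu>" if M: "M \<in> S" "good M" "row_weights M = \<nu>" for M
  proof -
    have row_le: "ent M i (Suc j) \<le> ent M i j" for i j
    proof (induction i arbitrary: j rule: less_induct)
      case (less i)
      show ?case
      proof (rule ccontr)
        assume "\<not> ent M i (Suc j) \<le> ent M i j"
        then have 01: "ent M i (Suc j) = 1" "ent M i j = 0"
          using S_entries(1)[OF M(1), of i "Suc j"] by auto
        have Suc_j: "Suc j < L" using S_entries(3)[OF M(1), of i "Suc j"] 01 by simp
        \<comment> \<open>Row i reads 0, 1 in columns j and \<open>Suc j\<close>. Goodness at
          \<open>Suc j\<close> forces every earlier row to have an entry from that column on, and by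
          induction these rows are left-justified. So both columns are full above row i, and the
          shape after row i is no partition.\<close>
        have "ent M i' j = 1 \<and> ent M i' (Suc j) = 1" if "i' < i" for i'
        proof -
          have anti: "antimono (suffix M (Suc j))"
            using M(2) by (simp add: antimono_iff_le_Suc good_def bad_def not_less)
          have "1 \<le> suffix M (Suc j) i"
            using suffix_Suc[OF Suc_j, of M i] 01 by simp
          also have "\<dots> \<le> suffix M (Suc j) i'"
            using anti that by (simp add: antimonoD)
          finally have "(\<Sum>j'=Suc j..<L. ent M i' j') \<noteq> 0" unfolding suffix_def by (metis add_0_right lookup_zero not_one_le_zero)
          then obtain j' where j': "Suc j \<le> j'" "ent M i' j' \<noteq> 0"
            by (metis (no_types, lifting) atLeastLessThan_iff sum.neutral)
          have "antimono (ent M i')" using less.IH[OF that] by (simp add: antimono_iff_le_Suc)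
          then have "ent M i' j' \<le> ent M i' (Suc j)" "ent M i' (Suc j) \<le> ent M i' j"
            using j'(1) by (simp_all add: antimonoD)
          then show ?thesis
            using j'(2) S_entries(1)[OF M(1), of i' j] S_entries(1)[OF M(1), of i' "Suc j"] by linarith
        qed
        then have "prefix M (Suc i) j = i" "prefix M (Suc i) (Suc j) = Suc i"
          using 01 by (simp_all add: prefix_def)
        moreover have "prefix M (Suc i) (Suc j) \<le> prefix M (Suc i) j"
          using S_entries(5)[OF M(1), of "Suc i"] by (simp add: antimono_iff_le_Suc)
        ultimately show False by simp
      qed
    qed
    have "ent M i j = Y i j" for i j
    proof -
      have "nm_row M i \<in> int_partitions" using row_le by (simp add: int_partitions_iff)
      moreover have "weight (nm_row M i) = lk \<nu> i" using M(3) lookup_row_weights by metis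
      ultimately show ?thesis
        using binary_partition_entries[of "nm_row M i" j] S_entries(1)[OF M(1)] by (simp add: Y_def)
    qed
    then have Y: "ent M = Y" by (simp add: fun_eq_iff)
    have "lk ?l j = lk (conj_partition \<nu>) j" for j
      using S_entries(4)[OF M(1), of j] sum_conj_partition[OF \<nu>(2), of j] \<open>\<And>i j. ent M i j = Y i j\<close>
      by (simp add: prefix_def Y_def)
    then have "?l = conj_partition \<nu>" by (rule poly_mapping_eqI)
    then show ?thesis using Y conj_partition_eq_iff[OF \<rho> \<nu>(1)] by simp
  qed
  show ?thesis
  proof (cases "\<rho> = \<nu>")
    case True
    have bound: "lk \<nu> i \<le> L" for i
      using conj_partition_galois[OF \<nu>(1), of i L] L True by (simp add: keys_subset_iff not_less)
    have "ent (mat_of Y) = Y"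
      by (rule ent_mat_of[of _ n L])
         (use \<nu>(2) bound in \<open>auto simp: Y_def keys_subset_iff not_le_imp_less intro: less_le_trans ccontr\<close>)
    then have entY: "ent (mat_of Y) i j = Y i j" for i j by metis
    have in_S: "mat_of Y \<in> S"
      unfolding S_iff
    proof (intro conjI allI impI)
      fix i j
      show "ent (mat_of Y) i j \<le> 1" unfolding entY by (simp add: Y_def)
      assume "ent (mat_of Y) i j \<noteq> 0"
      then have "j < lk \<nu> i" unfolding entY by (simp add: Y_def)
      then show "i < n" "j < L"
        using \<nu>(2) bound[of i] by (auto simp: keys_subset_iff not_less[symmetric])
    next
      fix j show "prefix (mat_of Y) n j = lk ?l j"
        using sum_conj_partition[OF \<nu>(2), of j] True unfolding prefix_def entY by (simp add: Y_def)
    next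
      fix t show "antimono (prefix (mat_of Y) t)"
        unfolding antimono_iff_le_Suc prefix_def entY by (auto simp: Y_def intro!: card_mono)
    qed
    have "good (mat_of Y)"
      using \<nu>(1) unfolding good_def bad_def not_less suffix_def entY int_partitions_iff
      by (auto simp: Y_def intro!: card_mono intro: less_le_trans)
    moreover have "row_weights (mat_of Y) = \<nu>"
      by (rule poly_mapping_eqI)
         (simp add: lookup_row_weights weight_row[OF in_S] entY, simp add: Y_def sum_of_bool_less bound min_absorb2
           del: sum_of_bool_eq)
    ultimately have "{M \<in> S. good M \<and> row_weights M = \<nu>} = {mat_of Y}"
      using in_S diagram entY by (auto intro!: nat_matrix_eqI)
    then show ?thesis using True by simp
  next
    case False
    then have "{M \<in> S. good M \<and> row_weights M = \<nu>} = {}" using diagram by blast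
    then have "card {M \<in> S. good M \<and> row_weights M = \<nu>} = 0" by (simp only: card.empty)
    then show ?thesis using False by simp
  qed
qed

lemma lookup_tableau_sf_times_delta:
  assumes \<rho>: "\<rho> \<in> int_partitions" and \<nu>: "\<nu> \<in> int_partitions" "Poly_Mapping.keys \<nu> \<subseteq> {..<n}"
  shows "lk (sf_poly n (tableau_sf \<rho> 0) * alternant n (delta_comp n)) (stair n \<nu>) = of_bool (\<rho> = \<nu>)"
proof -
  obtain L where L: "Poly_Mapping.keys (conj_partition \<rho>) \<subseteq> {..<L}" using keys_bound by blast
  show ?thesis
    using lookup_tableau_sf_times_alternant[OF _ \<rho> _ _ \<nu> L, of 0 0] card_straight_shape[OF \<rho> \<nu> L]
    by simp
qed

section \<open>Identification of the Schur functions\<close>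

lemma alternant_delta_nonzero: "alternant n (delta_comp n) \<noteq> 0"
proof
  assume "alternant n (delta_comp n) = 0"
  then show False using lookup_alternant_stair[of 0 n 0] by simp
qed

text \<open>The tableau polynomial is a witness for the quotient, and cancelling the nonzero
  alternant makes it unique. If \<open>\<rho>\<close> has more than n parts, the product vanishes at
  every \<open>stair n \<nu>\<close>, so the tableau polynomial is 0, the default of
  \<open>schur_poly\<close>.\<close>

lemma schur_poly_eq:
  assumes \<rho>: "\<rho> \<in> int_partitions"
  shows "schur_poly n \<rho> = sf_poly n (tableau_sf \<rho> 0)"
proof -
  let ?p = "sf_poly n (tableau_sf \<rho> 0)" and ?d = "alternant n (delta_comp n)"
  have anti: "alternating n (?p * ?d)"
    by (intro alternating_sf_poly_times alternating_alternant keys_delta_comp)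
  show ?thesis
  proof (cases "Poly_Mapping.keys \<rho> \<subseteq> {..<n}")
    case True
    have "?p * ?d - alternant n (stair n \<rho>) = 0"
    proof (rule alternating_zero)
      show "alternating n (?p * ?d - alternant n (stair n \<rho>))"
        by (intro alternating_diff anti alternating_alternant keys_stair True)
    qed (simp add: lookup_minus lookup_tableau_sf_times_delta lookup_alternant_stair \<rho> True)
    then have eq: "?p * ?d = alternant n (stair n \<rho>)" by simp
    then have "(THE p. p * ?d = alternant n (stair n \<rho>)) = ?p"
    proof (rule the_equality)
      fix p assume "p * ?d = alternant n (stair n \<rho>)"
      then have "p * ?d = ?p * ?d" using eq by simp
      then show "p = ?p" using alternant_delta_nonzero by (metis mult_right_cancel)
    qed
    then show ?thesis using True by (simp add: schur_poly_def)
  next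
    case False
    have "?p * ?d = 0"
    proof (rule alternating_zero[OF anti])
      fix \<nu> assume "\<nu> \<in> int_partitions" "Poly_Mapping.keys \<nu> \<subseteq> {..<n}"
      then show "lk (?p * ?d) (stair n \<nu>) = 0"
        using False by (auto simp: lookup_tableau_sf_times_delta[OF \<rho>])
    qed
    then show ?thesis using False alternant_delta_nonzero by (simp add: schur_poly_def)
  qed
qed

lemma symfun_eqI: "(\<And>m. sf_coeff f m = sf_coeff g m) \<Longrightarrow> f = g"
  by (simp add: sf_coeff_inject[symmetric] fun_eq_iff)

lemma schur_eq:
  assumes "\<rho> \<in> int_partitions"
  shows "schur \<rho> = tableau_sf \<rho> 0"
  unfolding schur_def
proof (rule the_equality)
  show "\<forall>n. sf_restrict n (tableau_sf \<rho> 0) = lk (schur_poly n \<rho>)"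
    by (simp add: schur_poly_eq[OF assms] lookup_sf_poly)
next
  fix f assume f: "\<forall>n. sf_restrict n f = lk (schur_poly n \<rho>)"
  show "f = tableau_sf \<rho> 0"
  proof (rule symfun_eqI)
    fix m :: composition
    obtain n where "Poly_Mapping.keys m \<subseteq> {..<n}" using keys_bound[of m] by blast
    moreover have "sf_restrict n f m = sf_restrict n (tableau_sf \<rho> 0) m"
      by (simp add: f schur_poly_eq[OF assms] lookup_sf_poly)
    ultimately show "sf_coeff f m = sf_coeff (tableau_sf \<rho> 0) m"
      by (simp add: sf_restrict_def)
  qed
qed

lemma lookup_schur_times_delta:
  "\<rho> \<in> int_partitions \<Longrightarrow> \<nu> \<in> int_partitions \<Longrightarrow> Poly_Mapping.keys \<nu> \<subseteq> {..<n} \<Longrightarrow>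
    lk (sf_poly n (schur \<rho>) * alternant n (delta_comp n)) (stair n \<nu>) = of_bool (\<rho> = \<nu>)"
  by (simp add: schur_eq lookup_tableau_sf_times_delta)

lemma sf_poly_schur_times_delta:
  assumes "\<rho> \<in> int_partitions" "Poly_Mapping.keys \<rho> \<subseteq> {..<n}"
  shows "sf_poly n (schur \<rho>) * alternant n (delta_comp n) = alternant n (stair n \<rho>)"
proof -
  have "sf_poly n (schur \<rho>) * alternant n (delta_comp n) - alternant n (stair n \<rho>) = 0"
    by (rule alternating_zero)
       (use assms in \<open>auto intro!: alternating_diff alternating_sf_poly_times alternating_alternant keys_delta_comp keys_stair
          simp: lookup_minus lookup_schur_times_delta lookup_alternant_stair\<close>)
  then show ?thesis by simp
qed

section \<open>Schur functions as an integral basis\<close>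

lemma sf_coeff_schur_nonzero:
  assumes "\<rho> \<in> int_partitions" "sf_coeff (schur \<rho>) m \<noteq> 0"
  shows "weight m = weight \<rho>"
proof -
  have "wstrips 0 (conj_partition \<rho>) m \<noteq> {}"
    using assms by (auto simp: schur_eq tableau_sf.rep_eq skew_coeff_def)
  then show ?thesis
    using weight_wstrips weight_conj_partition[OF assms(1)] by (fastforce simp: weight_def[of 0])
qed

text \<open>The denominator is homogeneous, so a coordinate at \<open>\<rho>\<close> can only come
  from monomials of f of the same weight. Such degree bounds keep the later expansions
  finite.\<close>

lemma lookup_sf_poly_times_alternant_nonzero:
  assumes "lk (sf_poly n f * alternant n (stair n 0)) (stair n \<rho>) \<noteq> 0" "Poly_Mapping.keys \<rho> \<subseteq> {..<n}"
  shows "\<exists>a. sf_coeff f a \<noteq> 0 \<and> weight a = weight \<rho>"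
proof -
  have 0: "Poly_Mapping.keys (stair n 0) \<subseteq> {..<n}" by (rule keys_stair) simp
  obtain \<sigma> where \<sigma>: "\<sigma> permutes {..<n}" "shifted_coeff f (perm \<sigma> (stair n \<rho>)) (stair n 0) \<noteq> 0"
    using assms(1) unfolding lookup_sf_poly_times_alternant[OF 0 keys_stair[OF assms(2)]]
    by (auto elim!: sum.not_neutral_contains_not_neutral)
  let ?v = "perm \<sigma> (stair n \<rho>)"
  have "?v - stair n 0 + stair n 0 = ?v" "sf_coeff f (?v - stair n 0) \<noteq> 0"
    using \<sigma>(2) by (auto simp: shifted_coeff_def split: if_splits)
  moreover have "weight ?v = weight (stair n \<rho>)" using \<sigma>(1) by (simp add: weight_perm permutes_bij)
  ultimately have "weight (?v - stair n 0) + weight (stair n 0) = weight \<rho> + weight (stair n 0)"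
    by (metis add.commute add.right_neutral weight_add)
  then show ?thesis using \<open>sf_coeff f (?v - stair n 0) \<noteq> 0\<close> by auto
qed

lemma keys_partition_weight:
  assumes "\<rho> \<in> int_partitions" "weight \<rho> \<le> d"
  shows "Poly_Mapping.keys \<rho> \<subseteq> {..<d}"
proof
  fix i assume "i \<in> Poly_Mapping.keys \<rho>"
  then have "1 \<le> lk \<rho> j" if "j \<le> i" for j
    using int_partitionsD[OF assms(1) that] by (simp add: in_keys_iff)
  then have sub: "{..i} \<subseteq> Poly_Mapping.keys \<rho>" by (force simp: in_keys_iff)
  have "Suc i = (\<Sum>j\<le>i. 1)" by simp
  also have "\<dots> \<le> (\<Sum>j\<le>i. lk \<rho> j)" using \<open>\<And>j. j \<le> i \<Longrightarrow> 1 \<le> lk \<rho> j\<close> by (intro sum_mono) simp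
  also have "\<dots> \<le> weight \<rho>" unfolding weight_def by (rule sum_mono2) (use sub in auto)
  finally show "i \<in> {..<d}" using assms(2) by simp
qed

lemma symfun_zeroI:
  assumes d: "\<And>m. sf_coeff f m \<noteq> 0 \<Longrightarrow> weight m \<le> d" and "sf_poly d f = 0"
  shows "f = 0"
proof (rule symfun_eqI)
  fix m
  have "sf_coeff f m = 0"
  proof (rule ccontr)
    assume ne: "sf_coeff f m \<noteq> 0"
    obtain n where "Poly_Mapping.keys m \<subseteq> {..<n}" using keys_bound by blast
    then obtain \<sigma> where \<sigma>: "\<sigma> permutes {..<n}" "perm \<sigma> m \<in> int_partitions"
      using perm_sort by blast
    have bij: "bij \<sigma>" using \<sigma>(1) by (rule permutes_bij)
    have "Poly_Mapping.keys (perm \<sigma> m) \<subseteq> {..<d}"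
      using keys_partition_weight[OF \<sigma>(2)] d[OF ne] by (simp add: weight_perm bij)
    then have "sf_coeff f m = lk (sf_poly d f) (perm \<sigma> m)"
      by (simp add: lookup_sf_poly sf_restrict_def sf_coeff_perm bij)
    then show False using ne assms(2) by simp
  qed
  then show "sf_coeff f m = sf_coeff 0 m" by (simp add: zero_symfun.rep_eq)
qed

text \<open>For n at least the length of the partition \<open>\<rho>\<close> this is the coefficient
  of \<open>schur \<rho>\<close> in the Schur expansion of f.\<close>

definition schur_coord :: "nat \<Rightarrow> composition \<Rightarrow> symfun \<Rightarrow> int" where
  "schur_coord n \<rho> f = lk (sf_poly n f * alternant n (delta_comp n)) (stair n \<rho>)"

lemma schur_coord_add: "schur_coord n \<rho> (f + g) = schur_coord n \<rho> f + schur_coord n \<rho> g"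
  by (simp add: schur_coord_def sf_poly_add distrib_right lookup_add)

lemma schur_coord_schur:
  "\<rho> \<in> int_partitions \<Longrightarrow> \<nu> \<in> int_partitions \<Longrightarrow> Poly_Mapping.keys \<nu> \<subseteq> {..<n} \<Longrightarrow>
    schur_coord n \<nu> (schur \<rho>) = of_bool (\<rho> = \<nu>)"
  by (simp add: schur_coord_def lookup_schur_times_delta)

lemma additive_int_combination:
  fixes \<phi> :: "symfun \<Rightarrow> int"
  assumes add: "\<And>f g. \<phi> (f + g) = \<phi> f + \<phi> g"
  shows "\<phi> (\<Sum>x\<in>F. of_int (a x) * h x) = (\<Sum>x\<in>F. a x * \<phi> (h x))"
proof -
  have 0: "\<phi> 0 = 0" using add[of 0 0] by simp
  have neg: "\<phi> (- f) = - \<phi> f" for f using add[of f "- f"] 0 by simp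
  have scale: "\<phi> (of_int c * f) = c * \<phi> f" for c f
  proof (induction c rule: int_induct[where k = 0])
    case (step1 i)
    then show ?case using add[of "of_int i * f" f] by (simp add: distrib_right)
  next
    case (step2 i)
    then show ?case using add[of "of_int i * f" "- f"] neg[of f] by (simp add: left_diff_distrib)
  qed (simp add: 0)
  show ?thesis
    by (induction F rule: infinite_finite_induct) (simp_all add: 0 add scale)
qed

lemma finite_partitions_weight: "finite {\<rho> \<in> int_partitions. weight \<rho> \<le> d}"
  by (rule finite_subset[OF _ finite_bounded_compositions[of d d]]) (use keys_partition_weight in auto)

text \<open>d serves both as degree bound and as number of indeterminates: d indeterminates see
  every orbit of monomials of degree at most d. The remainder \<open>f - g\<close> has only zero
  coordinates, so it is 0.\<close>

lemma schur_span: "\<exists>F a. finite F \<and> F \<subseteq> int_partitions \<and> f = (\<Sum>\<rho>\<in>F. of_int (a \<rho>) * schur \<rho>)"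
proof -
  obtain d where d: "\<forall>m. sf_coeff f m \<noteq> 0 \<longrightarrow> weight m \<le> d" using sf_degree by blast
  define F where "F = {\<rho> \<in> int_partitions. weight \<rho> \<le> d}"
  define g where "g = (\<Sum>\<rho>\<in>F. of_int (schur_coord d \<rho> f) * schur \<rho>)"
  have fin: "finite F" unfolding F_def by (rule finite_partitions_weight)
  have coord_g: "schur_coord d \<nu> g = (if \<nu> \<in> F then schur_coord d \<nu> f else 0)"
    if "\<nu> \<in> int_partitions" "Poly_Mapping.keys \<nu> \<subseteq> {..<d}" for \<nu>
  proof -
    have "schur_coord d \<nu> g = (\<Sum>\<rho>\<in>F. schur_coord d \<rho> f * of_bool (\<rho> = \<nu>))"
      unfolding g_def additive_int_combination[of "schur_coord d \<nu>", OF schur_coord_add]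
      by (intro sum.cong refl) (use that in \<open>auto simp: F_def schur_coord_schur\<close>)
    then show ?thesis using fin by (simp add: of_bool_def if_distrib cong: if_cong)
  qed
  have "f - g = 0"
  proof (rule symfun_zeroI[of _ d])
    have "(\<Sum>\<rho>\<in>F. schur_coord d \<rho> f * sf_coeff (schur \<rho>) m) = sf_coeff g m" for m
      unfolding g_def
      by (rule additive_int_combination[symmetric]) (simp add: plus_symfun.rep_eq)
    then have "sf_coeff g m \<noteq> 0 \<Longrightarrow> weight m \<le> d" for m
      using sf_coeff_schur_nonzero by (metis (mono_tags, lifting) F_def mem_Collect_eq mult_zero_right sum.neutral)
    moreover have "sf_coeff (f - g) m = sf_coeff f m + - sf_coeff g m" for m
      unfolding minus_symfun_def plus_symfun.rep_eq uminus_symfun.rep_eq ..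
    ultimately show "weight m \<le> d" if "sf_coeff (f - g) m \<noteq> 0" for m
      using d that by (metis add.right_neutral add.left_neutral neg_0_equal_iff_equal)
    have "sf_poly d (f - g) * alternant d (delta_comp d) = 0"
    proof (rule alternating_zero)
      show "alternating d (sf_poly d (f - g) * alternant d (delta_comp d))"
        by (intro alternating_sf_poly_times alternating_alternant keys_delta_comp)
      fix \<nu> assume \<nu>: "\<nu> \<in> int_partitions" "Poly_Mapping.keys \<nu> \<subseteq> {..<d}"
      have "schur_coord d \<nu> f = schur_coord d \<nu> g"
      proof (cases "\<nu> \<in> F")
        case False
        then have "\<not> weight \<nu> \<le> d" using \<nu> by (simp add: F_def)
        then have "schur_coord d \<nu> f = 0"
          using lookup_sf_poly_times_alternant_nonzero[OF _ \<nu>(2), of f] d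
          unfolding schur_coord_def add_0_right by metis
        then show ?thesis using coord_g[OF \<nu>] False by simp
      qed (simp add: coord_g[OF \<nu>])
      moreover have "schur_coord d \<nu> f = schur_coord d \<nu> (f - g) + schur_coord d \<nu> g"
        using schur_coord_add[of d \<nu> "f - g" g] by simp
      ultimately show "lk (sf_poly d (f - g) * alternant d (delta_comp d)) (stair d \<nu>) = 0"
        by (simp add: schur_coord_def)
    qed
    then show "sf_poly d (f - g) = 0" using alternant_delta_nonzero by simp
  qed
  then show ?thesis using fin by (intro exI[of _ F]) (auto simp: g_def F_def)
qed

lemma additive_eqI:
  fixes \<phi> \<psi> :: "symfun \<Rightarrow> int"
  assumes "\<And>f g. \<phi> (f + g) = \<phi> f + \<phi> g" "\<And>f g. \<psi> (f + g) = \<psi> f + \<psi> g"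
    and "\<And>\<rho>. \<rho> \<in> int_partitions \<Longrightarrow> \<phi> (schur \<rho>) = \<psi> (schur \<rho>)"
  shows "\<phi> f = \<psi> f"
proof -
  obtain F a where "F \<subseteq> int_partitions" and f: "f = (\<Sum>\<rho>\<in>F. of_int (a \<rho>) * schur \<rho>)"
    using schur_span by blast
  then show ?thesis
    unfolding f additive_int_combination[of \<phi>, OF assms(1)] additive_int_combination[of \<psi>, OF assms(2)]
    by (intro sum.cong refl) (auto simp: assms(3))
qed

text \<open>Any n that is large enough may be chosen; \<open>coord_eq\<close> shows that all give
  the same value.\<close>

definition coord :: "composition \<Rightarrow> symfun \<Rightarrow> int" where
  "coord \<rho> = schur_coord (SOME n. Poly_Mapping.keys \<rho> \<subseteq> {..<n}) \<rho>"

lemma coord_add: "coord \<rho> (f + g) = coord \<rho> f + coord \<rho> g"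
  by (simp add: coord_def schur_coord_add)

lemma coord_schur: "\<rho> \<in> int_partitions \<Longrightarrow> \<nu> \<in> int_partitions \<Longrightarrow> coord \<nu> (schur \<rho>) = of_bool (\<rho> = \<nu>)"
  unfolding coord_def by (rule schur_coord_schur) (use someI_ex[OF keys_bound] in auto)

lemma coord_eq:
  assumes "\<rho> \<in> int_partitions" "Poly_Mapping.keys \<rho> \<subseteq> {..<n}"
  shows "coord \<rho> f = lk (sf_poly n f * alternant n (delta_comp n)) (stair n \<rho>)"
  unfolding schur_coord_def[symmetric]
  by (rule additive_eqI) (simp_all add: coord_add schur_coord_add coord_schur schur_coord_schur assms)

lemma coord_combination:
  assumes "finite F" "F \<subseteq> int_partitions" "\<nu> \<in> int_partitions"
  shows "coord \<nu> (\<Sum>\<rho>\<in>F. of_int (a \<rho>) * schur \<rho>) = (if \<nu> \<in> F then a \<nu> else 0)"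
proof -
  have "coord \<nu> (\<Sum>\<rho>\<in>F. of_int (a \<rho>) * schur \<rho>) = (\<Sum>\<rho>\<in>F. a \<rho> * of_bool (\<rho> = \<nu>))"
    unfolding additive_int_combination[of "coord \<nu>", OF coord_add]
    by (intro sum.cong refl) (use assms in \<open>auto simp: coord_schur\<close>)
  then show ?thesis using assms(1) by (simp add: of_bool_def if_distrib cong: if_cong)
qed

abbreviation coord_support :: "symfun \<Rightarrow> composition set" where
  "coord_support f \<equiv> {\<rho> \<in> int_partitions. coord \<rho> f \<noteq> 0}"

lemma schur_expansion:
  "finite (coord_support f) \<and> f = (\<Sum>\<rho>\<in>coord_support f. of_int (coord \<rho> f) * schur \<rho>)"
proof -
  obtain F a where F: "finite F" "F \<subseteq> int_partitions" and f: "f = (\<Sum>\<rho>\<in>F. of_int (a \<rho>) * schur \<rho>)"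
    using schur_span by blast
  have a: "coord \<rho> f = (if \<rho> \<in> F then a \<rho> else 0)" if "\<rho> \<in> int_partitions" for \<rho>
    unfolding f by (rule coord_combination[OF F that])
  then have sub: "coord_support f \<subseteq> F" by (auto split: if_splits)
  have "(\<Sum>\<rho>\<in>coord_support f. of_int (coord \<rho> f) * schur \<rho>) = (\<Sum>\<rho>\<in>F. of_int (a \<rho>) * schur \<rho>)"
    using F sub a by (intro sum.mono_neutral_cong_left) auto
  then show ?thesis using F(1) sub f finite_subset by auto
qed

lemma symfun_eq_coordI:
  assumes "\<And>\<rho>. \<rho> \<in> int_partitions \<Longrightarrow> coord \<rho> f = coord \<rho> g"
  shows "f = g"
proof -
  have "(\<Sum>\<rho>\<in>coord_support f. of_int (coord \<rho> f) * schur \<rho>) =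
      (\<Sum>\<rho>\<in>coord_support g. of_int (coord \<rho> g) * schur \<rho>)"
    using assms by (intro sum.cong) auto
  then show ?thesis
    using schur_expansion[THEN conjunct2] by metis
qed

section \<open>The scalar product and the adjoint\<close>

lemma sf_scalar_eq: "sf_scalar f g = (\<Sum>\<rho>\<in>coord_support f. coord \<rho> f * coord \<rho> g)"
proof -
  define B where "B = (\<lambda>f g. \<Sum>\<rho>\<in>coord_support f. coord \<rho> f * coord \<rho> g)"
  have B_eq: "B f g = (\<Sum>\<rho>\<in>A. coord \<rho> f * coord \<rho> g)"
    if "finite A" "coord_support f \<subseteq> A" "A \<subseteq> int_partitions" for f g A
    unfolding B_def using that by (intro sum.mono_neutral_left) auto
  have add_left: "B (f + g) h = B f h + B g h" for f g h
  proof -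
    let ?A = "coord_support f \<union> coord_support g"
    have A: "finite ?A" "?A \<subseteq> int_partitions" using schur_expansion by auto
    have "coord_support (f + g) \<subseteq> ?A" by (auto simp: coord_add)
    then show ?thesis
      using A by (simp add: B_eq[of ?A] coord_add distrib_right sum.distrib)
  qed
  have add_right: "B f (g + h) = B f g + B f h" for f g h
    by (simp add: B_def coord_add distrib_left sum.distrib)
  have basis: "B (schur \<rho>) (schur \<mu>) = of_bool (\<rho> = \<mu>)"
    if "\<rho> \<in> int_partitions" "\<mu> \<in> int_partitions" for \<rho> \<mu>
    using that by (subst B_eq[of "{\<rho>}"]) (auto simp: coord_schur)
  have "sf_scalar = B"
    unfolding sf_scalar_def
  proof (rule the_equality)
    fix B' :: "symfun \<Rightarrow> symfun \<Rightarrow> int"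
    assume B': "(\<forall>f g h. B' (f + g) h = B' f h + B' g h) \<and> (\<forall>f g h. B' f (g + h) = B' f g + B' f h) \<and>
      (\<forall>\<rho>\<in>int_partitions. \<forall>\<mu>\<in>int_partitions. B' (schur \<rho>) (schur \<mu>) = of_bool (\<rho> = \<mu>))"
    \<comment> \<open>Uniqueness takes two rounds: the second argument varies against a fixed Schur
      function, then the first argument varies.\<close>
    have "B' (schur \<rho>) g = B (schur \<rho>) g" if "\<rho> \<in> int_partitions" for \<rho> and g :: symfun
      by (rule additive_eqI) (use B' that in \<open>auto simp: add_right basis\<close>)
    note B'_schur = this
    have "B' f g = B f g" for f g
    proof (rule additive_eqI[of "\<lambda>f. B' f g" "\<lambda>f. B f g"])
      show "B' (f + h) g = B' f g + B' h g" for f h using B' by blast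
      show "B (f + h) g = B f g + B h g" for f h by (rule add_left)
    qed (rule B'_schur)
    then show "B' = B" by (simp add: fun_eq_iff)
  qed (use add_left add_right basis in auto)
  then show ?thesis unfolding B_def by metis
qed

lemma sf_scalar_commute: "sf_scalar f g = sf_scalar g f"
proof -
  have eq: "(\<Sum>\<rho>\<in>coord_support f. coord \<rho> f * coord \<rho> g) =
      (\<Sum>\<rho>\<in>coord_support f \<inter> coord_support g. coord \<rho> f * coord \<rho> g)" for f g
    using schur_expansion by (intro sum.mono_neutral_right) auto
  show ?thesis
    unfolding sf_scalar_eq eq[of f g] eq[of g f] by (simp add: Int_commute mult.commute)
qed

lemma sf_scalar_add_right: "sf_scalar f (g + h) = sf_scalar f g + sf_scalar f h"
  by (simp add: sf_scalar_eq coord_add distrib_left sum.distrib)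

lemma sf_scalar_schur:
  assumes "\<rho> \<in> int_partitions"
  shows "sf_scalar (schur \<rho>) f = coord \<rho> f"
proof -
  have "coord_support (schur \<rho>) = {\<rho>}" using assms by (auto simp: coord_schur)
  then show ?thesis using assms by (simp add: sf_scalar_eq coord_schur)
qed

text \<open>Multiplication by h cannot lower the degree, so only finitely many Schur functions have
  products that reach a given \<open>\<tau>\<close>. The adjoint can therefore be written as a
  finite sum.\<close>

lemma coord_times_schur_weight:
  assumes \<rho>: "\<rho> \<in> int_partitions" and \<tau>: "\<tau> \<in> int_partitions" and ne: "coord \<tau> (h * schur \<rho>) \<noteq> 0"
  shows "weight \<rho> \<le> weight \<tau>"
proof -
  obtain n where n: "Poly_Mapping.keys \<tau> \<subseteq> {..<n}" using keys_bound by blast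
  then obtain a where a: "sf_coeff (h * schur \<rho>) a \<noteq> 0" "weight a = weight \<tau>"
    using ne lookup_sf_poly_times_alternant_nonzero[of n "h * schur \<rho>" \<tau>] by (auto simp: coord_eq[OF \<tau> n])
  then obtain x y where "x + y = a" "sf_coeff (schur \<rho>) y \<noteq> 0"
    by (auto simp: times_symfun.rep_eq ps_times_def elim!: sum.not_neutral_contains_not_neutral)
  then show ?thesis
    using a(2) sf_coeff_schur_nonzero[OF \<rho>] weight_add by (metis le_add2)
qed

lemma sf_scalar_adjoint_mult: "sf_scalar (adjoint_mult h f) g = sf_scalar f (h * g)"
proof -
  define X where "X = (\<lambda>f. {\<rho> \<in> int_partitions. sf_scalar f (h * schur \<rho>) \<noteq> 0})"
  define T where "T = (\<lambda>f. \<Sum>\<rho>\<in>X f. of_int (sf_scalar f (h * schur \<rho>)) * schur \<rho>)"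
  have finite_X: "finite (X f)" for f
  proof -
    \<comment> \<open>A crude bound on the weights occurring in f; a sum, unlike a maximum, also
      makes sense for \<open>f = 0\<close>.\<close>
    define D where "D = (\<Sum>\<tau>\<in>coord_support f. weight \<tau>)"
    have fin: "finite (coord_support f)" using schur_expansion by blast
    have "weight \<rho> \<le> D" if "\<rho> \<in> X f" for \<rho>
    proof -
      have \<rho>: "\<rho> \<in> int_partitions" "sf_scalar f (h * schur \<rho>) \<noteq> 0" using that by (auto simp: X_def)
      then obtain \<tau> where \<tau>: "\<tau> \<in> coord_support f" "coord \<tau> (h * schur \<rho>) \<noteq> 0"
        unfolding sf_scalar_eq by (auto elim!: sum.not_neutral_contains_not_neutral)
      then have "weight \<rho> \<le> weight \<tau>" using coord_times_schur_weight[OF \<rho>(1)] by simp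
      also have "weight \<tau> \<le> D" unfolding D_def by (rule member_le_sum) (use \<tau> fin in auto)
      finally show ?thesis .
    qed
    then have "X f \<subseteq> {\<rho> \<in> int_partitions. weight \<rho> \<le> D}" by (auto simp: X_def)
    then show ?thesis using finite_partitions_weight finite_subset by blast
  qed
  have coord_T: "coord \<rho> (T f) = sf_scalar f (h * schur \<rho>)" if "\<rho> \<in> int_partitions" for \<rho> f
  proof -
    have "coord \<rho> (T f) = (if \<rho> \<in> X f then sf_scalar f (h * schur \<rho>) else 0)"
      unfolding T_def by (rule coord_combination[OF finite_X _ that]) (auto simp: X_def)
    then show ?thesis using that by (auto simp: X_def)
  qed
  have T: "sf_scalar (T f) g = sf_scalar f (h * g)" for f g
  proof (rule additive_eqI[of "sf_scalar (T f)"])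
    fix \<rho> assume "\<rho> \<in> int_partitions"
    then show "sf_scalar (T f) (schur \<rho>) = sf_scalar f (h * schur \<rho>)"
      by (metis coord_T sf_scalar_commute sf_scalar_schur)
  qed (simp_all add: sf_scalar_add_right distrib_left)
  have "adjoint_mult h = T"
    unfolding adjoint_mult_def
  proof (rule the_equality)
    fix T' assume T': "\<forall>f g. sf_scalar (T' f) g = sf_scalar f (h * g)"
    show "T' = T"
    proof
      fix f
      show "T' f = T f"
        by (rule symfun_eq_coordI) (metis T T' sf_scalar_commute sf_scalar_schur)
    qed
  qed (simp add: T)
  then show ?thesis by (simp add: T)
qed

text \<open>This is the duality of complete and monomial symmetric functions. On a Schur function
  both sides count the same chains of strips.\<close>

lemma sf_scalar_complete_prod: "sf_scalar (complete_prod \<beta>) f = sf_coeff f \<beta>"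
proof (rule additive_eqI[of "sf_scalar (complete_prod \<beta>)" "\<lambda>f. sf_coeff f \<beta>"])
  fix \<rho> assume \<rho>: "\<rho> \<in> int_partitions"
  obtain n where n: "Poly_Mapping.keys \<rho> \<subseteq> {..<n}" using keys_bound by blast
  have "sf_scalar (complete_prod \<beta>) (schur \<rho>) = coord \<rho> (complete_prod \<beta>)"
    by (metis \<rho> sf_scalar_commute sf_scalar_schur)
  also have "\<dots> = sf_coeff (schur \<rho>) \<beta>"
    using card_wstrips[of 0 n \<rho> \<beta>] \<rho> n
    by (simp add: coord_eq[OF \<rho> n] schur_eq tableau_sf.rep_eq skew_coeff_def)
  finally show "sf_scalar (complete_prod \<beta>) (schur \<rho>) = sf_coeff (schur \<rho>) \<beta>" .
qed (simp_all add: sf_scalar_add_right plus_symfun.rep_eq)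

lemma coord_schur_times:
  assumes "\<rho> \<in> int_partitions" "Poly_Mapping.keys \<rho> \<subseteq> {..<n}"
    and "\<kappa> \<in> int_partitions" "Poly_Mapping.keys \<kappa> \<subseteq> {..<n}"
  shows "coord \<rho> (schur \<kappa> * f) = lk (sf_poly n f * alternant n (stair n \<kappa>)) (stair n \<rho>)"
  unfolding coord_eq[OF assms(1,2)] sf_poly_schur_times_delta[OF assms(3,4), symmetric] sf_poly_times
  by (simp add: mult_ac)

lemma sf_scalar_skew_schur: "sf_scalar (skew_schur \<rho> \<kappa>) f = sf_scalar (schur \<rho>) (schur \<kappa> * f)"
  by (simp add: skew_schur_def sf_scalar_adjoint_mult)

text \<open>The coefficient at \<open>\<beta>\<close> is the pairing with
  \<open>complete_prod \<beta>\<close>. Undoing the adjoint turns it into a coordinate of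
  \<open>schur \<kappa> * complete_prod \<beta>\<close>, which \<open>card_wstrips\<close>
  counts.\<close>

lemma skew_schur_eq:
  assumes \<rho>: "\<rho> \<in> int_partitions" and \<kappa>: "\<kappa> \<in> int_partitions"
  shows "skew_schur \<rho> \<kappa> = tableau_sf \<rho> \<kappa>"
proof (rule symfun_eqI)
  fix \<beta>
  obtain n where n: "Poly_Mapping.keys \<rho> \<subseteq> {..<n}" "Poly_Mapping.keys \<kappa> \<subseteq> {..<n}"
    using common_bound[of \<rho> \<kappa>] by blast
  have "sf_coeff (skew_schur \<rho> \<kappa>) \<beta> = sf_scalar (schur \<rho>) (schur \<kappa> * complete_prod \<beta>)"
    by (metis sf_scalar_complete_prod sf_scalar_commute sf_scalar_skew_schur)
  also have "\<dots> = coord \<rho> (schur \<kappa> * complete_prod \<beta>)" by (rule sf_scalar_schur[OF \<rho>])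
  also have "\<dots> = sf_coeff (tableau_sf \<rho> \<kappa>) \<beta>"
    using \<rho> \<kappa> n by (simp add: coord_schur_times[of _ n] card_wstrips[of _ n] tableau_sf.rep_eq skew_coeff_def)
  finally show "sf_coeff (skew_schur \<rho> \<kappa>) \<beta> = sf_coeff (tableau_sf \<rho> \<kappa>) \<beta>" .
qed

section \<open>Translation to the binary matrices of the theorem\<close>

lemma weight_nm_col:
  assumes "\<forall>i\<ge>n. nm_row M i = 0"
  shows "weight (nm_col M j) = (\<Sum>i<n. ent M i j)"
  using assms by (subst weight_superset[of "{..<n}"]) (auto simp: keys_subset_iff lookup_nm_col)

text \<open>\<open>comp_diff\<close> may be negative; in additive form the weight conditions then
  have no solution and both sets are empty. The sums over nonzero columns are finite stand-ins for
  the sums over all columns from t on.\<close>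

lemma binary_matrices_strips:
  assumes \<mu>: "\<mu> \<in> int_partitions" "Poly_Mapping.keys \<mu> \<subseteq> {..<n}" and \<nu>: "Poly_Mapping.keys \<nu> \<subseteq> {..<n}"
    and L: "Poly_Mapping.keys l \<subseteq> {..<L}"
  shows "{M \<in> binary_matrices (comp_diff \<nu> \<mu>) (comp_diff l k).
      (\<forall>t. k + (\<Sum>i<t. nm_row M i) \<in> int_partitions) \<and>
      (\<forall>t. \<mu> + (\<Sum>j | t \<le> j \<and> nm_col M j \<noteq> 0. nm_col M j) \<in> int_partitions)} =
    {M \<in> strips n k l. strip_matrices.good L \<mu> M \<and> row_weights M + \<mu> = \<nu>}"
proof -
  interpret strip_matrices n L k l \<mu>
    using \<mu> L by unfold_locales
  have good_iff: "good M \<longleftrightarrow> (\<forall>t. \<mu> + (\<Sum>j | t \<le> j \<and> nm_col M j \<noteq> 0. nm_col M j) \<in> int_partitions)"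
    if M: "M \<in> S" for M
  proof -
    have "lk (\<mu> + (\<Sum>j | t \<le> j \<and> nm_col M j \<noteq> 0. nm_col M j)) i = suffix M t i" for t i
    proof -
      have "ent M i j = 0" if "nm_col M j = 0" for i j
        using that lookup_nm_col[of M j i] by simp
      then have "(\<Sum>j | t \<le> j \<and> nm_col M j \<noteq> 0. ent M i j) = (\<Sum>j=t..<L. ent M i j)"
        using S_entries(3)[OF M] lookup_nm_col[of M]
        by (intro sum.mono_neutral_left) (auto simp: poly_mapping_eq_iff fun_eq_iff)
      then show ?thesis by (simp add: suffix_def lookup_add lookup_sum lookup_nm_col)
    qed
    then show ?thesis by (auto simp: good_def bad_def int_partitions_iff not_less)
  qed
  have row_iff: "(\<forall>i. int (weight (nm_row M i)) = comp_diff \<nu> \<mu> i) \<longleftrightarrow> row_weights M + \<mu> = \<nu>" for M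
    by (simp add: poly_mapping_eq_iff fun_eq_iff lookup_add lookup_row_weights comp_diff_def eq_diff_eq
        flip: of_nat_add)
  have col_iff: "(\<forall>j. int (weight (nm_col M j)) = comp_diff l k j) \<longleftrightarrow> k + (\<Sum>i<n. nm_row M i) = l"
    if "\<forall>i\<ge>n. nm_row M i = 0" for M
    unfolding weight_nm_col[OF that]
    by (simp add: poly_mapping_eq_iff fun_eq_iff lookup_add lookup_sum comp_diff_def eq_diff_eq add.commute
        flip: of_nat_add of_nat_sum)
  have rows0: "\<forall>i\<ge>n. nm_row M i = 0" if "row_weights M + \<mu> = \<nu>" for M
    using \<nu> unfolding that[symmetric] by (simp add: keys_subset_iff lookup_add lookup_row_weights weight_eq_0_iff)
  have bin: "(\<forall>i j. ent M i j \<in> {0, 1}) \<longleftrightarrow> (\<forall>i j. ent M i j \<le> 1)" for M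
    by (auto simp: le_Suc_eq)
  have "M \<in> binary_matrices (comp_diff \<nu> \<mu>) (comp_diff l k) \<and> (\<forall>t. k + (\<Sum>i<t. nm_row M i) \<in> int_partitions) \<longleftrightarrow>
      M \<in> S \<and> row_weights M + \<mu> = \<nu>" for M
    unfolding binary_matrices_def strips_def mem_Collect_eq row_iff bin
    using col_iff[of M] rows0[of M] by blast
  then show ?thesis using good_iff by blast
qed

theorem theorem5p1:
  fixes \<kappa> \<rho> \<mu> \<nu> :: composition
  assumes "\<kappa> \<in> int_partitions" and "\<rho> \<in> int_partitions"
    and "\<mu> \<in> int_partitions" and "\<nu> \<in> int_partitions"
  shows "sf_scalar (skew_schur \<rho> \<kappa>) (skew_schur \<nu> \<mu>) =
    (\<Sum>M \<in> binary_matrices (comp_diff \<nu> \<mu>) (comp_diff (conj_partition \<rho>) (conj_partition \<kappa>)).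
       of_bool (\<forall>k::nat. conj_partition \<kappa> + (\<Sum>i<k. nm_row M i) \<in> int_partitions) *
       of_bool (\<forall>l::nat. \<mu> + (\<Sum>j | l \<le> j \<and> nm_col M j \<noteq> 0. nm_col M j) \<in> int_partitions))"
    (is "_ = (\<Sum>M\<in>?B. of_bool (?P M) * of_bool (?Q M))")
proof -
  \<comment> \<open>n has to accommodate the exponents \<open>\<mu>\<close> and
    \<open>\<nu>\<close>, L the columns of the matrices.\<close>
  obtain n where n: "Poly_Mapping.keys \<mu> \<subseteq> {..<n}" "Poly_Mapping.keys \<nu> \<subseteq> {..<n}"
    using common_bound[of \<mu> \<nu>] by blast
  obtain L where L: "Poly_Mapping.keys (conj_partition \<rho>) \<subseteq> {..<L}" using keys_bound by blast
  have finite_diff: "finite {i. comp_diff \<alpha> \<beta> i \<noteq> 0}" for \<alpha> \<beta>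
    by (rule finite_subset[of _ "Poly_Mapping.keys \<alpha> \<union> Poly_Mapping.keys \<beta>"])
       (auto simp: comp_diff_def in_keys_iff)
  \<comment> \<open>Symmetry allows the adjoint to be undone on the side of \<open>\<nu>\<close> and
    \<open>\<mu>\<close>, which leaves a pairing with a single Schur function, that is, a
    coordinate.\<close>
  have "sf_scalar (skew_schur \<rho> \<kappa>) (skew_schur \<nu> \<mu>) = sf_scalar (schur \<nu>) (schur \<mu> * skew_schur \<rho> \<kappa>)"
    by (metis sf_scalar_commute sf_scalar_skew_schur)
  also have "\<dots> = lk (sf_poly n (tableau_sf \<rho> \<kappa>) * alternant n (stair n \<mu>)) (stair n \<nu>)"
    using assms n by (simp add: sf_scalar_schur skew_schur_eq coord_schur_times[of _ n])
  also have "\<dots> = int (card {M \<in> ?B. ?P M \<and> ?Q M})"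
    using lookup_tableau_sf_times_alternant[OF assms(1-3) n(1) assms(4) n(2) L]
      binary_matrices_strips[OF assms(3) n L, of "conj_partition \<kappa>"]
    by simp
  also have "\<dots> = (\<Sum>M\<in>?B. of_bool (?P M) * of_bool (?Q M))"
    using finite_binary_matrices[OF finite_diff finite_diff]
    by (simp add: of_bool_conj[symmetric] sum_of_bool_eq Int_def)
  finally show ?thesis .
qed

end
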